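(* There exist a non-decreasing function $r:(0,\pi/2)\to\mathbb{R}_+$ and a function $\gamma\in S(r)$ such that for all real $\alpha>r(0)$, $$\lambda_\alpha=\alpha+\gamma(\alpha)e^{-\alpha}.$$
   Context: For real $\alpha$, $\lambda_\alpha$ denotes the first (smallest) eigenvalue of the operator $-\partial_x^2+(\alpha x)^2$ on $L^2(-1,1)$ with Dirichlet boundary conditions (domain $H^1_0(-1,1)\cap H^2(-1,1)$). For a non-decreasing function $r:(0,\pi/2)\to\mathbb{R}_+$ and $\theta\in(0,\pi/2)$, let $U_{\theta,r(\theta)}=\{z\in\mathbb{C}: |z|>r(\theta),\ |\arg(z)|<\theta\}$. $S(r)$ is the set of functions $\gamma:\bigcup_{\theta\in(0,\pi/2)}U_{\theta,r(\theta)}\to\mathbb{C}$ that are holomorphic and such that for each $\theta\in(0,\pi/2)$ and $\epsilon>0$, $p_{\theta,\epsilon}(\gamma):=\sup_{z\in U_{\theta,r(\theta)}}|\gamma(z)e^{-\epsilon|z|}|<+\infty$. Also $r(0):=\inf_{\theta\in(0,\pi/2)}r(\theta)$. *)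

theory Defs
  imports "HOL-Complex_Analysis.Complex_Analysis"
begin

text \<open>Sobolev spaces of complex-valued functions on an open set \<open>\<Omega>\<close> of reals. Elements of
  \<open>L\<^sup>2(\<Omega>)\<close> are represented by functions on the whole line whose values outside \<open>\<Omega>\<close> are irrelevant;
  equality in \<open>L\<^sup>2(\<Omega>)\<close> is equality almost everywhere on \<open>\<Omega>\<close>.\<close>

definition L2 :: "real set \<Rightarrow> (real \<Rightarrow> complex) set" where
  "L2 \<Omega> = {f. f \<in> borel_measurable (lebesgue_on \<Omega>) \<and>
               integrable (lebesgue_on \<Omega>) (\<lambda>x. (cmod (f x))\<^sup>2)}"

definition smooth :: "(real \<Rightarrow> complex) \<Rightarrow> bool" where
  "smooth \<phi> \<longleftrightarrow> (\<exists>D :: nat \<Rightarrow> real \<Rightarrow> complex. D 0 = \<phi> \<and>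
      (\<forall>n x. (D n has_vector_derivative D (Suc n) x) (at x)))"

definition test_functions :: "real set \<Rightarrow> (real \<Rightarrow> complex) set" where
  "test_functions \<Omega> = {\<phi>. smooth \<phi> \<and> (\<exists>K. compact K \<and> K \<subseteq> \<Omega> \<and> (\<forall>x. x \<notin> K \<longrightarrow> \<phi> x = 0))}"

abbreviation dx :: "(real \<Rightarrow> complex) \<Rightarrow> real \<Rightarrow> complex" where
  "dx \<phi> \<equiv> \<lambda>x. vector_derivative \<phi> (at x)"

definition weak_deriv :: "real set \<Rightarrow> (real \<Rightarrow> complex) \<Rightarrow> (real \<Rightarrow> complex) \<Rightarrow> bool" where
  "weak_deriv \<Omega> f g \<longleftrightarrow> f \<in> L2 \<Omega> \<and> g \<in> L2 \<Omega> \<and>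
     (\<forall>\<phi>\<in>test_functions \<Omega>.
        (LINT x|lebesgue_on \<Omega>. f x * dx \<phi> x) = - (LINT x|lebesgue_on \<Omega>. g x * \<phi> x))"

definition weak_deriv2 :: "real set \<Rightarrow> (real \<Rightarrow> complex) \<Rightarrow> (real \<Rightarrow> complex) \<Rightarrow> bool" where
  "weak_deriv2 \<Omega> f h \<longleftrightarrow> (\<exists>g. weak_deriv \<Omega> f g \<and> weak_deriv \<Omega> g h)"

definition H2 :: "real set \<Rightarrow> (real \<Rightarrow> complex) set" where
  "H2 \<Omega> = {f. \<exists>h. weak_deriv2 \<Omega> f h}"

text \<open>\<open>H\<^sup>1\<^sub>0(\<Omega>)\<close> is the closure of the test functions in the norm of \<open>H\<^sup>1(\<Omega>)\<close>.\<close>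

definition H10 :: "real set \<Rightarrow> (real \<Rightarrow> complex) set" where
  "H10 \<Omega> = {f. \<exists>g. weak_deriv \<Omega> f g \<and>
     (\<exists>\<phi> :: nat \<Rightarrow> real \<Rightarrow> complex. (\<forall>n. \<phi> n \<in> test_functions \<Omega>) \<and>
        (\<lambda>n. (LINT x|lebesgue_on \<Omega>. (cmod (f x - \<phi> n x))\<^sup>2) +
             (LINT x|lebesgue_on \<Omega>. (cmod (g x - dx (\<phi> n) x))\<^sup>2)) \<longlonglongrightarrow> 0)}"

abbreviation I :: "real set" where
  "I \<equiv> {-1<..<1}"

text \<open>The graph of the unbounded operator \<open>-\<partial>\<^sub>x\<^sup>2 + (\<alpha>x)\<^sup>2\<close> on \<open>L\<^sup>2(-1,1)\<close>: \<open>u\<close> lies in the domain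
  and is mapped to (the class of) \<open>v\<close>. The second weak derivative is unique up to null sets.\<close>

definition dirichlet_oscillator ::
    "real \<Rightarrow> (real \<Rightarrow> complex) \<Rightarrow> (real \<Rightarrow> complex) \<Rightarrow> bool" where
  "dirichlet_oscillator \<alpha> u v \<longleftrightarrow> u \<in> H10 I \<inter> H2 I \<and> v \<in> L2 I \<and>
     (\<exists>h. weak_deriv2 I u h \<and>
        (AE x in lebesgue_on I. v x = - h x + of_real ((\<alpha> * x)\<^sup>2) * u x))"

definition dirichlet_eigenvalue :: "real \<Rightarrow> complex \<Rightarrow> bool" where
  "dirichlet_eigenvalue \<alpha> \<mu> \<longleftrightarrow>
     (\<exists>u. dirichlet_oscillator \<alpha> u (\<lambda>x. \<mu> * u x) \<and> \<not> (AE x in lebesgue_on I. u x = 0))"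

text \<open>The operator is self-adjoint, so that all its eigenvalues are real and it makes sense to speak
  of the smallest one.\<close>

definition first_eigenvalue :: "real \<Rightarrow> real" where
  "first_eigenvalue \<alpha> = (LEAST l. dirichlet_eigenvalue \<alpha> (of_real l))"

definition sector :: "real \<Rightarrow> real \<Rightarrow> complex set" where
  "sector \<theta> \<rho> = {z. cmod z > \<rho> \<and> \<bar>Arg z\<bar> < \<theta>}"

definition symbol_domain :: "(real \<Rightarrow> real) \<Rightarrow> complex set" where
  "symbol_domain r = (\<Union>\<theta>\<in>{0<..<pi/2}. sector \<theta> (r \<theta>))"

definition symbol_seminorm ::
    "(real \<Rightarrow> real) \<Rightarrow> real \<Rightarrow> real \<Rightarrow> (complex \<Rightarrow> complex) \<Rightarrow> ennreal" where
  "symbol_seminorm r \<theta> \<epsilon> \<gamma> =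
     (SUP z\<in>sector \<theta> (r \<theta>). ennreal (cmod (\<gamma> z * of_real (exp (- \<epsilon> * cmod z)))))"

definition symbols :: "(real \<Rightarrow> real) \<Rightarrow> (complex \<Rightarrow> complex) set" where
  "symbols r = {\<gamma>. \<gamma> holomorphic_on symbol_domain r \<and>
     (\<forall>\<theta>\<in>{0<..<pi/2}. \<forall>\<epsilon>>0. symbol_seminorm r \<theta> \<epsilon> \<gamma> < \<infinity>)}"

definition radius_at_zero :: "(real \<Rightarrow> real) \<Rightarrow> real" where
  "radius_at_zero r = (INF \<theta>\<in>{0<..<pi/2}. r \<theta>)"

end

theory Submission
  imports Defs
begin

text \<open>Writing the eigenvalue as \<open>z + d\<close>, even eigenfunctions are
  \<open>e\<^bsup>- z x\<^sup>2 / 2\<^esup> (1 - d G(x))\<close>, where \<open>G'' = 1 + 2 z x G' - d G\<close> and \<open>G(0) = G'(0) = 0\<close>; the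
  Dirichlet condition is \<open>d = 1 / G(1)\<close>. A Gronwall type estimate with weight \<open>e\<^bsup>Re z x\<^sup>2\<^esup>\<close>
  shows that \<open>G(1)\<close> depends on \<open>d\<close> with Lipschitz constant \<open>4 e\<^bsup>Re z\<^esup>\<close>, whereas for \<open>d = 0\<close> an
  integration by parts gives \<open>|G(1)| \<ge> e\<^bsup>Re z\<^esup> / (32 |z|\<^sup>2)\<close> in the region
  \<open>(Re z)\<^sup>2 > 1000 |z|\<close>. Hence \<open>d \<mapsto> 1 / G(1)\<close> is a contraction of the disc
  \<open>|d| \<le> 64 |z|\<^sup>2 e\<^bsup>- Re z\<^esup>\<close>, and its fixed point is holomorphic in \<open>z\<close>. The region contains
  every sector \<open>|arg z| < \<theta>\<close>, \<open>|z| > 1000 / cos\<^sup>2 \<theta>\<close>. For real \<open>z\<close> the function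
  \<open>1 - d G\<close> is positive on \<open>(-1,1)\<close>, so that by Jacobi's factorisation no eigenvalue lies below
  \<open>z + d\<close>.\<close>

section \<open>Even solutions of the Hermite equation\<close>

text \<open>At shift 0 the Gaussian e^(-z x^2/2) solves the equation with eigenvalue exactly z and
  misses the Dirichlet condition only by its value at 1; the shift repairs this, and its size is
  governed by the growth of G(1). For non-real z the operator is not self-adjoint, so the shift is
  built from the scalar equation d G(1) = 1 alone, and spectral information enters only for real z.
  The delicate point is the lower bound for |G(1)|: the integral of e^(-z s^2) oscillates when arg z
  is close to pi/2, so that an estimate covering all sectors must avoid cancellation. Every other
  estimate loses only powers of |z| against the gain e^(-Re z). The condition (Re z)^2 > 1000 |z|
  describes where Re z still beats these powers, in one region for all angles. The outcome is
  \<gamma>(z) = d(z) e^z with |\<gamma>(z)| \<le> 64 |z|^2, a polynomial bound that is the same in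
  every sector.\<close>

primrec osc_coeff :: "complex \<Rightarrow> complex \<Rightarrow> nat \<Rightarrow> complex" where
  "osc_coeff z d 0 = 0"
| "osc_coeff z d (Suc n) =
     ((if n = 0 then 1 else 0) + (4 * z * of_nat n - d) * osc_coeff z d n)
       / of_nat ((2 * n + 2) * (2 * n + 1))"

text \<open>The recursion multiplies by a factor linear in n and divides by one quadratic in n, so
  the ratio of consecutive terms tends to 0 for every \<open>w\<close>.\<close>

lemma summable_osc_coeff: "summable (\<lambda>n. osc_coeff z d n * w ^ n)"
proof -
  define A where "A = (4 * norm z + norm d) * norm w"
  have A0: "A \<ge> 0" by (simp add: A_def)
  obtain N :: nat where N: "2 * A \<le> real N" using real_arch_simple by blast
  show ?thesis
  proof (rule summable_ratio_test)
    show "(1/2::real) < 1" by simp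
    fix n assume n: "n \<ge> Suc N"
    have "norm (osc_coeff z d (Suc n) * w ^ Suc n)
        = norm (4 * z * of_nat n - d) * norm w / real ((2 * n + 2) * (2 * n + 1))
          * norm (osc_coeff z d n * w ^ n)"
      using n by (simp add: norm_mult norm_divide norm_power del: of_nat_mult of_nat_add of_nat_Suc)
    also have "\<dots> \<le> 1/2 * norm (osc_coeff z d n * w ^ n)"
    proof (rule mult_right_mono)
      have "norm (4 * z * of_nat n - d) \<le> norm (4 * z * of_nat n) + norm d"
        by (rule norm_triangle_ineq4)
      also have "\<dots> = 4 * norm z * real n + norm d * 1" by (simp add: norm_mult)
      also have "\<dots> \<le> 4 * norm z * real n + norm d * real n"
        using n by (intro add_left_mono mult_left_mono) auto
      finally have "norm (4 * z * of_nat n - d) \<le> (4 * norm z + norm d) * real n"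
        by (simp add: algebra_simps)
      hence "norm (4 * z * of_nat n - d) * norm w \<le> A * real n"
        unfolding A_def using mult_right_mono[OF _ norm_ge_zero[of w]] by (fastforce simp: mult_ac)
      also have "\<dots> \<le> real n * real n / 2"
        using N n A0 by (auto simp: field_simps intro!: mult_left_mono)
      also have "\<dots> \<le> 1/2 * real ((2 * n + 2) * (2 * n + 1))"
        by (simp add: algebra_simps)
      finally show "norm (4 * z * of_nat n - d) * norm w / real ((2 * n + 2) * (2 * n + 1)) \<le> 1/2"
        by (simp add: divide_simps del: of_nat_mult of_nat_add)
    qed simp
    finally show "norm (osc_coeff z d (Suc n) * w ^ Suc n) \<le> 1/2 * norm (osc_coeff z d n * w ^ n)" .
  qed
qed

text \<open>This is G. It is even, hence a power series in s^2, and comparing coefficients of s^(2n)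
  in G'' = 1 + 2 z s G' - d G gives the recursion of \<open>osc_coeff\<close>. The argument is
  complex because the eigenfunction is later used as an entire function.\<close>

definition osc :: "complex \<Rightarrow> complex \<Rightarrow> complex \<Rightarrow> complex" where
  "osc z d s = (\<Sum>n. osc_coeff z d n * (s\<^sup>2) ^ n)"

definition osc' :: "complex \<Rightarrow> complex \<Rightarrow> complex \<Rightarrow> complex" where
  "osc' z d s = 2 * s * (\<Sum>n. diffs (osc_coeff z d) n * (s\<^sup>2) ^ n)"

lemma osc_0 [simp]: "osc z d 0 = 0" and osc'_0 [simp]: "osc' z d 0 = 0"
  by (simp_all add: osc_def osc'_def powser_zero)

lemma osc_DERIV: "(osc z d has_field_derivative osc' z d s) (at s)"
proof -
  have "((\<lambda>w. \<Sum>n. osc_coeff z d n * w ^ n) has_field_derivative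
          (\<Sum>n. diffs (osc_coeff z d) n * (s\<^sup>2) ^ n)) (at (s\<^sup>2))"
    by (rule termdiffs_strong_converges_everywhere) (rule summable_osc_coeff)
  moreover have "((\<lambda>s. s\<^sup>2) has_field_derivative 2 * s) (at s)"
    by (auto intro!: derivative_eq_intros)
  ultimately show ?thesis
    unfolding osc_def[abs_def] osc'_def
    by (rule DERIV_chain2[THEN DERIV_cong]) simp
qed

text \<open>With w = s^2 and G = P(w) one has G' = 2 s P' and G'' = 2 P' + 4 w P'', so the equation
  becomes 4 w P'' + 2 P' - 4 z w P' + d P = 1, which the recursion makes true coefficient by
  coefficient.\<close>

lemma osc'_DERIV:
  "(osc' z d has_field_derivative 1 + 2 * z * s * osc' z d s - d * osc z d s) (at s)"
proof -
  let ?c = "osc_coeff z d"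
  define w where "w = s\<^sup>2"
  define P where "P = (\<Sum>n. ?c n * w ^ n)"
  define P1 where "P1 = (\<Sum>n. diffs ?c n * w ^ n)"
  define P2 where "P2 = (\<Sum>n. diffs (diffs ?c) n * w ^ n)"
  have s1: "summable (\<lambda>n. diffs ?c n * y ^ n)" for y
    using termdiff_converges_all[of ?c] summable_osc_coeff by blast
  have s2: "summable (\<lambda>n. diffs (diffs ?c) n * y ^ n)" for y
    using termdiff_converges_all[of "diffs ?c"] s1 by blast
  have D: "((\<lambda>w. \<Sum>n. diffs ?c n * w ^ n) has_field_derivative P2) (at (s\<^sup>2))"
    unfolding P2_def w_def by (rule termdiffs_strong_converges_everywhere) (rule s1)
  have D': "((\<lambda>s. \<Sum>n. diffs ?c n * (s\<^sup>2) ^ n) has_field_derivative P2 * (2 * s)) (at s)"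
    using D by (rule DERIV_chain2) (auto intro!: derivative_eq_intros)
  have D'': "(osc' z d has_field_derivative 2 * P1 + 2 * s * (P2 * (2 * s))) (at s)"
    unfolding osc'_def[abs_def]
    by (rule derivative_eq_intros D' refl)+ (simp add: P1_def w_def)
  have a0: "(\<lambda>n. ?c n * w ^ n) sums P"
    unfolding P_def by (rule summable_sums) (rule summable_osc_coeff)
  have a1: "(\<lambda>n. diffs ?c n * w ^ n) sums P1"
    unfolding P1_def by (rule summable_sums) (rule s1)
  have b1: "(\<lambda>n. w * (of_nat n * ?c n * w ^ (n - Suc 0))) sums (w * P1)"
    unfolding P1_def by (intro sums_mult diffs_equiv s1)
  have b2: "(\<lambda>n. w * (of_nat n * diffs ?c n * w ^ (n - Suc 0))) sums (w * P2)"
    unfolding P2_def by (intro sums_mult diffs_equiv s2)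
  have sh: "w * (of_nat n * a * w ^ (n - Suc 0)) = of_nat n * a * w ^ n" for n a
    by (cases n) auto
  have "(\<lambda>n. 4 * (of_nat n * diffs ?c n * w ^ n) + 2 * (diffs ?c n * w ^ n)
          - 4 * z * (of_nat n * ?c n * w ^ n) + d * (?c n * w ^ n))
        sums (4 * (w * P2) + 2 * P1 - 4 * z * (w * P1) + d * P)"
    by (intro sums_add sums_diff sums_mult a0 a1 b1[unfolded sh] b2[unfolded sh])
  also have "(\<lambda>n. 4 * (of_nat n * diffs ?c n * w ^ n) + 2 * (diffs ?c n * w ^ n)
          - 4 * z * (of_nat n * ?c n * w ^ n) + d * (?c n * w ^ n))
      = (\<lambda>n. if n = 0 then 1 else 0)"
  proof
    fix n :: nat
    have nz: "of_nat ((2 * n + 2) * (2 * n + 1)) \<noteq> (0::complex)"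
      by (simp del: of_nat_mult of_nat_add of_nat_Suc)
    have e: "of_nat ((2 * n + 2) * (2 * n + 1)) * ?c (Suc n)
       = (if n = 0 then 1 else 0) + (4 * z * of_nat n - d) * ?c n"
      using nz by (simp del: of_nat_mult of_nat_add of_nat_Suc)
    have "4 * (of_nat n * diffs ?c n * w ^ n) + 2 * (diffs ?c n * w ^ n)
          - 4 * z * (of_nat n * ?c n * w ^ n) + d * (?c n * w ^ n)
      = (of_nat ((2 * n + 2) * (2 * n + 1)) * ?c (Suc n) - (4 * z * of_nat n - d) * ?c n) * w ^ n"
      unfolding diffs_def by (simp add: algebra_simps del: osc_coeff.simps)
    also have "\<dots> = (if n = 0 then 1 else 0)"
      unfolding e by simp
    finally show "4 * (of_nat n * diffs ?c n * w ^ n) + 2 * (diffs ?c n * w ^ n)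
          - 4 * z * (of_nat n * ?c n * w ^ n) + d * (?c n * w ^ n)
        = (if n = 0 then 1 else 0)" .
  qed
  finally have "4 * (w * P2) + 2 * P1 - 4 * z * (w * P1) + d * P = 1"
    by (rule sums_unique2) (use sums_single[of 0 "\<lambda>_. 1::complex"] in simp)
  moreover have "osc z d s = P" "osc' z d s = 2 * s * P1"
    by (simp_all add: osc_def osc'_def P_def P1_def w_def)
  ultimately have "2 * P1 + 2 * s * (P2 * (2 * s)) = 1 + 2 * z * s * osc' z d s - d * osc z d s"
    unfolding w_def by (simp add: power2_eq_square) (simp add: algebra_simps)
  with D'' show ?thesis by simp
qed

section \<open>Gronwall estimates with a Gaussian weight\<close>

lemma norm_diff_le_of_vector_derivative_le:
  fixes u :: "real \<Rightarrow> 'a::real_normed_vector"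
  assumes d: "\<And>t. (u has_vector_derivative u' t) (at t)"
    and b: "\<And>t. a < t \<Longrightarrow> t < b \<Longrightarrow> norm (u' t) \<le> B" and "a \<le> b"
  shows "norm (u b - u a) \<le> B * (b - a)"
proof (cases "a = b")
  case False
  have "norm (u b - u a) \<le> B * b - B * a"
  proof (rule differentiable_bound_general[where f' = u' and \<phi>' = "\<lambda>_. B"])
    show "continuous_on {a..b} u"
      by (meson d continuous_at_imp_continuous_on has_vector_derivative_continuous)
    show "((*) B has_vector_derivative B) (at x)" for x
      by (auto intro!: derivative_eq_intros)
  qed (use False assms in \<open>auto intro!: continuous_intros\<close>)
  thus ?thesis by (simp add: algebra_simps)
qed simp

lemma norm_le_of_vector_derivative_le:
  fixes u :: "real \<Rightarrow> 'a::real_normed_vector"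
  assumes "u 0 = 0" and d: "\<And>t. (u has_vector_derivative u' t) (at t)"
    and b: "\<And>t. 0 < t \<Longrightarrow> t < s \<Longrightarrow> norm (u' t) \<le> B" and "0 \<le> s"
  shows "norm (u s) \<le> B * s"
  using norm_diff_le_of_vector_derivative_le[of u u' 0 s B, OF d b] assms by simp

lemma exp_gauss_has_vector_derivative:
  "((\<lambda>s. exp (- z * (of_real s)\<^sup>2)) has_vector_derivative
     - (2 * z * of_real s) * exp (- z * (of_real s)\<^sup>2)) (at s within A)" for z :: complex
  by (rule has_vector_derivative_real_field) (auto intro!: derivative_eq_intros)

lemma norm_exp_gauss: "norm (exp (- z * (of_real s)\<^sup>2)) = exp (- Re z * s\<^sup>2)"
  by (simp add: Re_power2 flip: of_real_power)

text \<open>The integrating factor e^(-z s^2) removes the first order term of the equation.\<close>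

lemma gauss_weighted_derivative:
  fixes z :: complex
  assumes "(u' has_vector_derivative 2 * z * of_real s * u' s + g) (at s)"
  shows "((\<lambda>s. u' s * exp (- z * (of_real s)\<^sup>2)) has_vector_derivative
           g * exp (- z * (of_real s)\<^sup>2)) (at s)"
  by (rule has_vector_derivative_eq_rhs,
      rule has_vector_derivative_mult[OF assms exp_gauss_has_vector_derivative])
     (simp add: algebra_simps)

text \<open>The weighted derivative u' e^(-z s^2) has a derivative of norm at most \<open>B\<close>,
  so it is itself bounded by \<open>B\<close> on [0,1]. Undoing the weight and integrating once more
  costs only factors s \<le> 1: no power of |z| is lost.\<close>

lemma gauss_ode_bound:
  fixes z :: complex
  assumes z: "Re z \<ge> 0" and u0: "u 0 = 0" "u' 0 = 0"
    and d: "\<And>s. (u has_vector_derivative u' s) (at s)"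
    and d': "\<And>s. (u' has_vector_derivative 2 * z * of_real s * u' s + g s) (at s)"
    and g: "\<And>s. 0 \<le> s \<Longrightarrow> s \<le> 1 \<Longrightarrow> norm (g s) \<le> B * exp (Re z * s\<^sup>2)"
    and s: "0 \<le> s" "s \<le> 1"
  shows "norm (u s) \<le> B * exp (Re z * s\<^sup>2)"
proof -
  define w where "w = (\<lambda>s. u' s * exp (- z * (of_real s)\<^sup>2))"
  have dw: "(w has_vector_derivative g s * exp (- z * (of_real s)\<^sup>2)) (at s)" for s
    unfolding w_def by (rule gauss_weighted_derivative) (rule d')
  have B: "B \<ge> 0"
    using order_trans[OF norm_ge_zero g[of 0]] by simp
  have w: "norm (w t) \<le> B" if "0 \<le> t" "t \<le> 1" for t
  proof -
    have "norm (w t) \<le> B * t"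
    proof (rule norm_le_of_vector_derivative_le[OF _ dw])
      show "norm (g r * exp (- z * (of_real r)\<^sup>2)) \<le> B" if "0 < r" "r < t" for r
      proof -
        have "norm (g r * exp (- z * (of_real r)\<^sup>2)) = norm (g r) * exp (- Re z * r\<^sup>2)"
          by (simp only: norm_mult norm_exp_gauss)
        also have "\<dots> \<le> B * exp (Re z * r\<^sup>2) * exp (- Re z * r\<^sup>2)"
          using g[of r] that \<open>t \<le> 1\<close> by (intro mult_right_mono) auto
        also have "\<dots> = B" by (simp add: exp_minus)
        finally show ?thesis .
      qed
    qed (use that u0 in \<open>auto simp: w_def\<close>)
    also have "\<dots> \<le> B" using B that by (simp add: mult_left_le)
    finally show ?thesis .
  qed
  have "norm (u s) \<le> B * exp (Re z * s\<^sup>2) * s"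
  proof (rule norm_le_of_vector_derivative_le[OF _ d])
    fix t assume t: "0 < t" "t < s"
    have "norm (u' t) = norm (w t) * exp (Re z * t\<^sup>2)"
      by (simp only: w_def norm_mult norm_exp_gauss) (simp add: exp_minus)
    also have "\<dots> \<le> B * exp (Re z * s\<^sup>2)"
      using w[of t] t s z B by (intro mult_mono) (auto intro!: mult_left_mono power_mono)
    finally show "norm (u' t) \<le> B * exp (Re z * s\<^sup>2)" .
  qed (use u0 s in auto)
  also have "\<dots> \<le> B * exp (Re z * s\<^sup>2)"
    using B s by (intro mult_left_le) auto
  finally show ?thesis .
qed

text \<open>The zeroth order term is absorbed by bounding the supremum of \<open>|u(s)| e\<^bsup>- Re z s\<^sup>2\<^esup>\<close>
  in terms of itself.\<close>

lemma gauss_ode_bound_perturbed: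
  fixes z d :: complex
  assumes z: "Re z \<ge> 0" and dd: "norm d \<le> 1/2" and u0: "u 0 = 0" "u' 0 = 0"
    and d: "\<And>s. (u has_vector_derivative u' s) (at s)"
    and d': "\<And>s. (u' has_vector_derivative 2 * z * of_real s * u' s + (g s - d * u s)) (at s)"
    and g: "\<And>s. 0 \<le> s \<Longrightarrow> s \<le> 1 \<Longrightarrow> norm (g s) \<le> B * exp (Re z * s\<^sup>2)"
    and s: "0 \<le> s" "s \<le> 1"
  shows "norm (u s) \<le> 2 * B * exp (Re z * s\<^sup>2)"
proof -
  define f where "f = (\<lambda>s. norm (u s) * exp (- Re z * s\<^sup>2))"
  have "continuous_on {0..1} u"
    by (meson d continuous_at_imp_continuous_on has_vector_derivative_continuous)
  hence "continuous_on {0..1} f"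
    unfolding f_def by (intro continuous_intros)
  then obtain t where t: "t \<in> {0..1}" "\<And>s. s \<in> {0..1} \<Longrightarrow> f s \<le> f t"
    using continuous_attains_sup[of "{0..1::real}" f] by auto
  define m where "m = f t"
  have uf: "norm (u s) = f s * exp (Re z * s\<^sup>2)" for s
    by (simp add: f_def exp_minus)
  have bd: "norm (g s - d * u s) \<le> (B + m / 2) * exp (Re z * s\<^sup>2)" if "0 \<le> s" "s \<le> 1" for s
  proof -
    have "norm (g s - d * u s) \<le> norm (g s) + norm d * norm (u s)"
      using norm_triangle_ineq4[of "g s" "d * u s"] by (simp add: norm_mult)
    also have "norm d * norm (u s) \<le> 1/2 * (m * exp (Re z * s\<^sup>2))"
      unfolding uf using dd t(2)[of s] that
      by (intro mult_mono) (auto simp: m_def f_def)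
    also note g[OF that]
    finally show ?thesis by (simp add: algebra_simps)
  qed
  have le: "norm (u s) \<le> (B + m / 2) * exp (Re z * s\<^sup>2)" if "0 \<le> s" "s \<le> 1" for s
    by (rule gauss_ode_bound[OF z u0 d d' bd that])
  \<comment> \<open>At the maximiser \<open>t\<close> the estimate reads m \<le> B + m/2, that is m
    \<le> 2 B; the factor 1/2 is the bound on |d|.\<close>
  have "m * exp (Re z * t\<^sup>2) \<le> (B + m / 2) * exp (Re z * t\<^sup>2)"
    using le[of t] t unfolding uf m_def by auto
  hence "B + m / 2 \<le> 2 * B" by simp
  hence "(B + m / 2) * exp (Re z * s\<^sup>2) \<le> 2 * B * exp (Re z * s\<^sup>2)"
    by (rule mult_right_mono) simp
  with le[OF s] show ?thesis by (rule order_trans)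
qed

lemma osc_has_vector_derivative:
  "((\<lambda>s. osc z d (of_real s)) has_vector_derivative osc' z d (of_real s)) (at s)"
  by (rule has_vector_derivative_real_field) (rule osc_DERIV)

lemma osc'_has_vector_derivative:
  "((\<lambda>s. osc' z d (of_real s)) has_vector_derivative
     2 * z * of_real s * osc' z d (of_real s) + (1 - d * osc z d (of_real s))) (at s)"
  by (rule has_vector_derivative_eq_rhs,
      rule has_vector_derivative_real_field[OF osc'_DERIV]) (simp add: algebra_simps)

lemma norm_osc_le:
  assumes "Re z \<ge> 0" "norm d \<le> 1/2" "0 \<le> s" "s \<le> 1"
  shows "norm (osc z d (of_real s)) \<le> 2 * exp (Re z * s\<^sup>2)"
proof -
  have "norm (osc z d (of_real s)) \<le> 2 * 1 * exp (Re z * s\<^sup>2)"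
    by (rule gauss_ode_bound_perturbed[where u = "\<lambda>s. osc z d (of_real s)",
          OF assms(1,2) _ _ osc_has_vector_derivative osc'_has_vector_derivative _ assms(3,4)])
       (use assms in auto)
  thus ?thesis by simp
qed

text \<open>The difference of the solutions for \<open>d\<close> and \<open>e\<close> solves the
  equation with shift \<open>d\<close> and inhomogeneity -(d - e) times the solution for
  \<open>e\<close>, whose size is known from \<open>norm_osc_le\<close>.\<close>

lemma norm_osc_diff_le:
  assumes z: "Re z \<ge> 0" and d: "norm d \<le> 1/2" "norm e \<le> 1/2" and s: "0 \<le> s" "s \<le> 1"
  shows "norm (osc z d (of_real s) - osc z e (of_real s)) \<le> 4 * norm (d - e) * exp (Re z * s\<^sup>2)"
proof -
  have "norm (osc z d (of_real s) - osc z e (of_real s)) \<le> 2 * (2 * norm (d - e)) * exp (Re z * s\<^sup>2)"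
  proof (rule gauss_ode_bound_perturbed[where d = d
        and u = "\<lambda>s. osc z d (of_real s) - osc z e (of_real s)"
        and u' = "\<lambda>s. osc' z d (of_real s) - osc' z e (of_real s)"
        and g = "\<lambda>s. - (d - e) * osc z e (of_real s)", OF z d(1) _ _ _ _ _ s])
    show "((\<lambda>s. osc z d (of_real s) - osc z e (of_real s)) has_vector_derivative
             osc' z d (of_real s) - osc' z e (of_real s)) (at s)" for s
      by (intro derivative_intros osc_has_vector_derivative)
    show "((\<lambda>s. osc' z d (of_real s) - osc' z e (of_real s)) has_vector_derivative
             2 * z * of_real s * (osc' z d (of_real s) - osc' z e (of_real s)) +
             (- (d - e) * osc z e (of_real s)
               - d * (osc z d (of_real s) - osc z e (of_real s)))) (at s)" for s
      by (rule has_vector_derivative_eq_rhs,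
          rule has_vector_derivative_diff[OF osc'_has_vector_derivative osc'_has_vector_derivative])
         (simp add: algebra_simps)
    show "norm (- (d - e) * osc z e (of_real s)) \<le> 2 * norm (d - e) * exp (Re z * s\<^sup>2)"
      if "0 \<le> s" "s \<le> 1" for s
      using mult_left_mono[OF norm_osc_le[OF z d(2) that] norm_ge_zero[of "d - e"]]
      by (simp add: norm_mult norm_minus_commute mult_ac)
  qed auto
  thus ?thesis by simp
qed

section \<open>A lower bound for the solution at shift zero\<close>

lemma norm_one_minus_exp_gauss_le:
  fixes z :: complex
  assumes "Re z \<ge> 0" "s \<ge> 0"
  shows "norm (1 - exp (- z * (of_real s)\<^sup>2)) \<le> 2 * norm z * s\<^sup>2"
proof -
  have "norm (1 - exp (- z * (of_real s)\<^sup>2)) \<le> 2 * norm z * s * s"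
  proof (rule norm_le_of_vector_derivative_le)
    show "((\<lambda>s. 1 - exp (- z * (of_real s)\<^sup>2)) has_vector_derivative
            2 * z * of_real t * exp (- z * (of_real t)\<^sup>2)) (at t)" for t
      by (rule has_vector_derivative_eq_rhs,
          rule has_vector_derivative_diff[OF has_vector_derivative_const exp_gauss_has_vector_derivative])
         simp
    show "norm (2 * z * of_real t * exp (- z * (of_real t)\<^sup>2)) \<le> 2 * norm z * s"
      if "0 < t" "t < s" for t
    proof -
      have "norm (2 * z * of_real t * exp (- z * (of_real t)\<^sup>2)) = 2 * norm z * t * exp (- Re z * t\<^sup>2)"
        using that by (simp only: norm_mult norm_exp_gauss) simp
      also have "\<dots> \<le> 2 * norm z * t * 1"
        using that assms by (intro mult_left_mono) auto
      also have "\<dots> \<le> 2 * norm z * s" using that by (auto intro!: mult_left_mono)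
      finally show ?thesis .
    qed
  qed (use assms in auto)
  thus ?thesis by (simp add: power2_eq_square mult_ac)
qed

lemma norm_exp_gauss_le_1: "Re z \<ge> 0 \<Longrightarrow> norm (exp (- z * (of_real s)\<^sup>2)) \<le> 1"
  unfolding norm_exp_gauss by simp

text \<open>At shift 0 the equation is of first order in G', so this is the integral of e^(-z t^2)
  over [0,s], obtained from the power series instead of from an integral.\<close>

definition gauss_int :: "complex \<Rightarrow> real \<Rightarrow> complex" where
  "gauss_int z s = osc' z 0 (of_real s) * exp (- z * (of_real s)\<^sup>2)"

lemma gauss_int_0 [simp]: "gauss_int z 0 = 0"
  by (simp add: gauss_int_def)

lemma gauss_int_has_vector_derivative:
  "(gauss_int z has_vector_derivative exp (- z * (of_real s)\<^sup>2)) (at s within A)"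
proof -
  have "((\<lambda>s. osc' z 0 (of_real s) * exp (- z * (of_real s)\<^sup>2)) has_vector_derivative
          (1 - 0 * osc z 0 (of_real s)) * exp (- z * (of_real s)\<^sup>2)) (at s)"
    by (intro gauss_weighted_derivative osc'_has_vector_derivative)
  thus ?thesis
    unfolding gauss_int_def[abs_def] by (auto intro: has_vector_derivative_at_within)
qed

lemma norm_gauss_int_le:
  assumes "Re z \<ge> 0" "s \<ge> 0"
  shows "norm (gauss_int z s) \<le> s"
proof -
  have "norm (gauss_int z s) \<le> 1 * s"
    by (rule norm_le_of_vector_derivative_le[OF _ gauss_int_has_vector_derivative])
       (use assms norm_exp_gauss_le_1 in auto)
  thus ?thesis by simp
qed

text \<open>Integration by parts gives
  \<open>2 z \<integral>\<^sub>0\<^sup>1 e\<^bsup>- z s\<^sup>2\<^esup> ds = (1 - e\<^bsup>-z\<^esup>) + \<integral>\<^sub>0\<^sup>1 (1 - e\<^bsup>- z s\<^sup>2\<^esup>) / s\<^sup>2 ds\<close>, where the last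
  integrand has nonnegative real part: no cancellation occurs although \<open>z\<close> is complex.\<close>

lemma Re_gauss_int_ge:
  assumes z: "Re z \<ge> 0"
  shows "Re (z * gauss_int z 1) \<ge> Re (1 - exp (- z)) / 2"
proof -
  define \<psi> where "\<psi> = (\<lambda>s::real. Re (1 - exp (- z * (of_real s)\<^sup>2)))"
  \<comment> \<open>The derivative of \<open>k\<close> is \<psi>(s) / (2 s^2) \<ge> 0, because
    \<psi>'(s) / (2 s) cancels the derivative of the first term. The quotient is singular at 0, so
    monotonicity is used on [\<epsilon>, 1] only, with \<epsilon> tending to 0.\<close>
  define k where "k = (\<lambda>s. Re (z * gauss_int z s) - \<psi> s / (2 * s))"
  have \<psi>0: "\<psi> s \<ge> 0" for s
    using order_trans[OF complex_Re_le_cmod norm_exp_gauss_le_1[OF z]]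
    unfolding \<psi>_def minus_complex.sel one_complex.sel by simp
  have d\<psi>: "(\<psi> has_real_derivative Re (2 * z * of_real s * exp (- z * (of_real s)\<^sup>2))) (at s)" for s
  proof -
    have "((\<lambda>s. 1 - exp (- z * (of_real s)\<^sup>2)) has_vector_derivative
            2 * z * of_real s * exp (- z * (of_real s)\<^sup>2)) (at s)"
      by (rule has_vector_derivative_eq_rhs,
          rule has_vector_derivative_diff[OF has_vector_derivative_const exp_gauss_has_vector_derivative])
         simp
    from bounded_linear.has_vector_derivative[OF bounded_linear_Re this]
    show ?thesis
      by (simp add: \<psi>_def[abs_def] has_real_derivative_iff_has_vector_derivative)
  qed
  have dE: "((\<lambda>s. Re (z * gauss_int z s)) has_real_derivative
              Re (z * exp (- z * (of_real s)\<^sup>2))) (at s)" for s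
    using bounded_linear.has_vector_derivative[OF bounded_linear_Re
        has_vector_derivative_mult_right[OF gauss_int_has_vector_derivative[of z s UNIV], of z]]
    by (simp add: has_real_derivative_iff_has_vector_derivative)
  have dk: "(k has_real_derivative \<psi> s / (2 * s\<^sup>2)) (at s)" if "s > 0" for s
  proof -
    define a where "a = z * exp (- z * (of_real s)\<^sup>2)"
    have e: "2 * z * of_real s * exp (- z * (of_real s)\<^sup>2) = of_real (2 * s) * a"
      by (simp add: a_def)
    show ?thesis
      unfolding k_def
      by (rule derivative_eq_intros dE d\<psi> refl | use that in simp; fail)+
         (use that in \<open>simp add: e a_def[symmetric] power2_eq_square field_simps del: exp_minus mult_minus_left\<close>)
  qed
  have "0 \<le> k 1 + e" if "e > 0" for e
  proof -
    \<comment> \<open>Both terms of k(\<epsilon>) are at most |z| \<epsilon> in absolute value, so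
      k(\<epsilon>) \<ge> -2 |z| \<epsilon> \<ge> -e. The summand 1 keeps the denominator positive
      when z = 0.\<close>
    define \<epsilon> where "\<epsilon> = min 1 (e / (2 * norm z + 1))"
    have \<epsilon>: "0 < \<epsilon>" "\<epsilon> \<le> 1" "2 * norm z * \<epsilon> \<le> e"
    proof -
      have "2 * norm z * \<epsilon> \<le> (2 * norm z + 1) * \<epsilon>"
        using that by (simp add: \<epsilon>_def algebra_simps)
      also have "\<dots> \<le> (2 * norm z + 1) * (e / (2 * norm z + 1))"
        by (intro mult_left_mono) (auto simp: \<epsilon>_def)
      also have "\<dots> = e"
      proof -
        have "2 * norm z + 1 \<noteq> 0" using norm_ge_zero[of z] by linarith
        thus ?thesis by simp
      qed
      finally show "2 * norm z * \<epsilon> \<le> e" .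
      show "0 < \<epsilon>" using that by (auto simp: \<epsilon>_def intro!: divide_pos_pos add_nonneg_pos)
    qed (auto simp: \<epsilon>_def)
    have "k \<epsilon> \<le> k 1"
    proof (rule DERIV_nonneg_imp_nondecreasing[OF \<epsilon>(2)])
      fix s assume "\<epsilon> \<le> s" "s \<le> 1"
      hence "(k has_real_derivative \<psi> s / (2 * s\<^sup>2)) (at s)" "0 \<le> \<psi> s / (2 * s\<^sup>2)"
        using dk \<epsilon> \<psi>0[of s] by simp_all
      thus "\<exists>y. (k has_real_derivative y) (at s) \<and> 0 \<le> y" by blast
    qed
    moreover have "\<psi> \<epsilon> / (2 * \<epsilon>) \<le> norm z * \<epsilon>"
    proof -
      have "\<psi> \<epsilon> \<le> 2 * norm z * \<epsilon>\<^sup>2"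
        using norm_one_minus_exp_gauss_le[OF z, of \<epsilon>] \<epsilon> complex_Re_le_cmod[of "1 - exp (- z * (of_real \<epsilon>)\<^sup>2)"]
        unfolding \<psi>_def by linarith
      thus ?thesis using \<epsilon> by (simp add: field_simps power2_eq_square)
    qed
    moreover have "- (norm z * \<epsilon>) \<le> Re (z * gauss_int z \<epsilon>)"
    proof -
      have "norm (z * gauss_int z \<epsilon>) \<le> norm z * \<epsilon>"
        using norm_gauss_int_le[OF z, of \<epsilon>] \<epsilon> by (simp add: norm_mult mult_left_mono)
      thus ?thesis using abs_Re_le_cmod[of "z * gauss_int z \<epsilon>"] by linarith
    qed
    ultimately show ?thesis using \<epsilon>(3) unfolding k_def by linarith
  qed
  hence "0 \<le> k 1" by (rule field_le_epsilon)
  thus ?thesis by (simp add: k_def \<psi>_def)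
qed

text \<open>The constant is chosen so that \<open>e\<^bsup>x\<^esup> \<ge> (x/8)\<^sup>8\<close>, \<open>x = Re z\<close>, dominates the powers of \<open>|z|\<close>
  in the contraction estimate.\<close>

definition parabolic_region :: "complex set" where
  "parabolic_region = {z. 0 < Re z \<and> 1000 * norm z < (Re z)\<^sup>2}"

lemma parabolic_region_bounds:
  assumes "z \<in> parabolic_region"
  shows "1000 \<le> Re z" "1000 \<le> norm z" "50000 * norm z ^ 4 \<le> exp (Re z)"
    "200 * norm z ^ 2 \<le> exp (Re z)"
proof -
  from assms have z: "0 < Re z" "1000 * norm z < (Re z)\<^sup>2" by (auto simp: parabolic_region_def)
  have "1000 * Re z \<le> Re z * Re z"
    using z complex_Re_le_cmod[of z] unfolding power2_eq_square by linarith
  thus x: "1000 \<le> Re z" using z by simp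
  thus n: "1000 \<le> norm z" using complex_Re_le_cmod[of z] by simp
  have "(1000 * norm z) ^ 4 \<le> ((Re z)\<^sup>2) ^ 4"
    using z by (intro power_mono) auto
  moreover have "(1 + Re z / real 8) ^ 8 \<le> exp (Re z)"
    by (rule exp_ge_one_plus_x_over_n_power_n) (use z in auto)
  moreover have "(Re z / 8) ^ 8 \<le> (1 + Re z / real 8) ^ 8"
    using z by (intro power_mono) auto
  moreover have "0 \<le> norm z ^ 4" by simp
  ultimately show *: "50000 * norm z ^ 4 \<le> exp (Re z)"
  proof -
    \<comment> \<open>Here 16777216 = 8^8, and 10^12 / 8^8 exceeds 50000.\<close>
    have *: "50000 * a \<le> e" if "1000000000000 * a \<le> b" "b \<le> c * 16777216" "c \<le> e" "0 \<le> a"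
      for a b c e :: real using that by linarith
    assume "(1000 * norm z) ^ 4 \<le> ((Re z)\<^sup>2) ^ 4" "(1 + Re z / real 8) ^ 8 \<le> exp (Re z)"
      "(Re z / 8) ^ 8 \<le> (1 + Re z / real 8) ^ 8" "0 \<le> norm z ^ 4"
    thus ?thesis
      by (intro *[of "norm z ^ 4" "Re z ^ 8" "(1 + Re z / real 8) ^ 8"])
         (simp_all add: power_mult_distrib power_divide flip: power_mult)
  qed
  have "norm z ^ 2 \<le> norm z ^ 4" using n by (intro power_increasing) auto
  thus "200 * norm z ^ 2 \<le> exp (Re z)" using * zero_le_power2[of "norm z"] by linarith
qed

lemma Re_gauss_int_ge_quarter:
  assumes z: "z \<in> parabolic_region"
  shows "Re (z * gauss_int z 1) \<ge> 1/4"
proof -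
  note b = parabolic_region_bounds[OF z]
  have "exp (- Re z) \<le> 1/2"
    using order_trans[OF _ exp_ge_add_one_self[of "Re z"], of 2] b(1)
    by (simp add: exp_minus field_simps)
  moreover have "Re (exp (- z)) \<le> exp (- Re z)"
    using complex_Re_le_cmod[of "exp (- z)"] by (simp del: Re_exp)
  ultimately have "1/4 \<le> Re (1 - exp (- z)) / 2" by simp
  also have "\<dots> \<le> Re (z * gauss_int z 1)"
    by (rule Re_gauss_int_ge) (use b in auto)
  finally show ?thesis .
qed

lemma norm_gauss_int_ge:
  assumes z: "z \<in> parabolic_region"
  shows "norm (gauss_int z 1) \<ge> 1 / (4 * norm z)"
proof -
  have "1/4 \<le> norm z * norm (gauss_int z 1)"
    using order_trans[OF Re_gauss_int_ge_quarter[OF z] complex_Re_le_cmod] by (simp add: norm_mult)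
  hence "1 \<le> norm (gauss_int z 1) * (4 * norm z)" by (simp add: mult_ac)
  moreover have "0 < 4 * norm z" using parabolic_region_bounds(2)[OF z] by linarith
  ultimately show ?thesis by (subst pos_divide_le_eq)
qed

text \<open>The integral of e^(-z t^2) over [s,1] is at most e^(-Re z s^2), which the weight turns
  into the summand 1. The rest is expressed through the endpoint value \<open>gauss_int z 1\<close>,
  so that errors can be compared with a main term that is proportional to the same quantity.\<close>

lemma norm_osc'_zero_le:
  assumes "Re z \<ge> 0" "0 \<le> s" "s \<le> 1"
  shows "norm (osc' z 0 (of_real s)) \<le> 1 + norm (gauss_int z 1) * exp (Re z * s\<^sup>2)"
proof -
  have "norm (gauss_int z 1 - gauss_int z s) \<le> exp (- Re z * s\<^sup>2) * (1 - s)"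
  proof (rule norm_diff_le_of_vector_derivative_le[OF gauss_int_has_vector_derivative])
    show "norm (exp (- z * (of_real t)\<^sup>2)) \<le> exp (- Re z * s\<^sup>2)" if "s < t" "t < 1" for t
      unfolding norm_exp_gauss using that assms by (auto intro!: mult_left_mono power_mono)
  qed (use assms in auto)
  also have "\<dots> \<le> exp (- Re z * s\<^sup>2)" using assms by (intro mult_left_le) auto
  finally have "norm (gauss_int z s) \<le> exp (- Re z * s\<^sup>2) + norm (gauss_int z 1)"
    using norm_triangle_ineq2[of "gauss_int z s" "gauss_int z 1"] by (simp add: norm_minus_commute)
  hence "norm (gauss_int z s) * exp (Re z * s\<^sup>2)
      \<le> (exp (- Re z * s\<^sup>2) + norm (gauss_int z 1)) * exp (Re z * s\<^sup>2)"
    by (rule mult_right_mono) simp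
  moreover have "norm (gauss_int z s) = norm (osc' z 0 (of_real s)) * exp (- Re z * s\<^sup>2)"
    unfolding gauss_int_def norm_mult norm_exp_gauss ..
  ultimately show ?thesis by (simp add: exp_minus algebra_simps)
qed

text \<open>Dividing G'' - 1 = 2 z s G' by 2 z and subtracting it from G' leaves (1 - s) G', small
  where G' is largest. Hence G(1) equals (G'(1) - 1) / (2 z) up to the error X(1). With x = Re z and
  E = |\<open>gauss_int z 1\<close>| the main term has size E e^x / (2 |z|) and the error is about E
  e^x / x^2, at most half of it since 4 |z| \<le> x^2. The claim follows from E \<ge> 1 / (4
  |z|).\<close>

lemma norm_osc_zero_ge:
  assumes z: "z \<in> parabolic_region"
  shows "norm (osc z 0 1) \<ge> exp (Re z) / (32 * norm z ^ 2)"
proof -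
  note b = parabolic_region_bounds[OF z]
  define x where "x = Re z"
  define E where "E = norm (gauss_int z 1)"
  have x: "x > 0" and z0: "z \<noteq> 0" using b by (auto simp: x_def)
  define X where "X = (\<lambda>s::real. osc z 0 (of_real s) - (osc' z 0 (of_real s) - of_real s) / (2 * z))"
  have dX: "(X has_vector_derivative (1 - of_real s) * osc' z 0 (of_real s)) (at s)" for s
    unfolding X_def
    by (rule has_vector_derivative_eq_rhs, rule has_vector_derivative_diff[OF
         osc_has_vector_derivative has_vector_derivative_divide[OF
         has_vector_derivative_diff[OF osc'_has_vector_derivative has_vector_derivative_of_real[OF DERIV_ident]]]])
       (use z0 in \<open>simp add: field_simps\<close>)
  \<comment> \<open>The estimate s^2 \<le> s replaces the Gaussian by e^(x s), and (1 - s) e^(x s)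
    has the explicit antiderivative e^(x s) ((1 - s)/x + 1/x^2).\<close>
  define \<phi> where "\<phi> = (\<lambda>s. s + E * (exp (x * s) * ((1 - s) / x + 1 / x\<^sup>2)))"
  have d\<phi>: "(\<phi> has_vector_derivative 1 + E * ((1 - s) * exp (x * s))) (at s)" for s
    unfolding \<phi>_def has_real_derivative_iff_has_vector_derivative[symmetric]
    by (rule derivative_eq_intros refl | use x in simp; fail)+
       (use x in \<open>simp add: field_simps power2_eq_square\<close>)
  have "norm (X 1 - X 0) \<le> \<phi> 1 - \<phi> 0"
  proof (rule differentiable_bound_general[OF zero_less_one _ _ dX d\<phi>])
    show "continuous_on {0..1} X"
      by (meson dX continuous_at_imp_continuous_on has_vector_derivative_continuous)
    show "continuous_on {0..1} \<phi>"
      by (meson d\<phi> continuous_at_imp_continuous_on has_vector_derivative_continuous)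
    fix s :: real assume s: "0 < s" "s < 1"
    have "norm ((1 - of_real s) * osc' z 0 (of_real s)) = (1 - s) * norm (osc' z 0 (of_real s))"
    proof -
      have "1 - complex_of_real s = of_real (1 - s)" by simp
      thus ?thesis using s by (simp only: norm_mult norm_of_real abs_of_nonneg)
    qed
    also have "\<dots> \<le> (1 - s) * (1 + E * exp (x * s\<^sup>2))"
      unfolding E_def x_def using norm_osc'_zero_le[of z s] b s by (intro mult_left_mono) auto
    also have "\<dots> \<le> (1 - s) * (1 + E * exp (x * s))"
      using s x by (intro mult_left_mono add_left_mono) (auto simp: E_def power2_eq_square)
    also have "\<dots> \<le> 1 + E * ((1 - s) * exp (x * s))"
      using s by (simp add: algebra_simps)
    finally show "norm ((1 - of_real s) * osc' z 0 (of_real s)) \<le> 1 + E * ((1 - s) * exp (x * s))" .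
  qed
  also have "\<phi> 1 - \<phi> 0 \<le> 1 + E * exp x / x\<^sup>2"
    using x by (simp add: \<phi>_def E_def)
  finally have X1: "norm (X 1) \<le> 1 + E * exp x / x\<^sup>2" by (simp add: X_def)
  have W: "norm (osc' z 0 1) = E * exp x"
  proof -
    have "osc' z 0 1 = gauss_int z 1 * exp z"
      by (simp add: gauss_int_def exp_minus)
    thus ?thesis by (simp add: norm_mult E_def x_def)
  qed
  have "norm (osc' z 0 1) - 1 \<le> norm (osc' z 0 1 - 1)"
    using norm_triangle_ineq2[of "osc' z 0 1" 1] by simp
  hence "(E * exp x - 1) / (2 * norm z) \<le> norm ((osc' z 0 1 - 1) / (2 * z))"
    unfolding W by (simp add: norm_divide norm_mult divide_right_mono)
  also have "(osc' z 0 1 - 1) / (2 * z) = osc z 0 1 - X 1"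
    by (simp add: X_def)
  also have "norm \<dots> \<le> norm (osc z 0 1) + norm (X 1)"
    by (rule norm_triangle_ineq4)
  finally have 1: "(E * exp x - 1) / (2 * norm z) - 1 - E * exp x / x\<^sup>2 \<le> norm (osc z 0 1)"
    using X1 by linarith
  have "E * exp x / x\<^sup>2 \<le> E * exp x / (4 * norm z)"
  proof (rule divide_left_mono)
    show "4 * norm z \<le> x\<^sup>2"
      using z norm_ge_zero[of z] unfolding x_def parabolic_region_def mem_Collect_eq by linarith
  qed (use z0 x in \<open>auto simp: E_def\<close>)
  moreover have "1 / (2 * norm z) \<le> 1" using b(2) by (intro divide_le_eq_1_pos[THEN iffD2]) linarith+
  moreover have "(E * exp x - 1) / (2 * norm z) = 2 * (E * exp x / (4 * norm z)) - 1 / (2 * norm z)"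
    by (simp add: diff_divide_distrib)
  ultimately have 2: "E * exp x / (4 * norm z) - 2 \<le> norm (osc z 0 1)"
    using 1 by linarith
  have "1 / (4 * norm z) * exp x / (4 * norm z) \<le> E * exp x / (4 * norm z)"
    unfolding E_def using norm_gauss_int_ge[OF z] by (intro divide_right_mono mult_right_mono) auto
  moreover have "1 / (4 * norm z) * exp x / (4 * norm z) = 2 * (exp x / (32 * norm z ^ 2))"
    by (simp add: power2_eq_square)
  \<comment> \<open>The additive constant 2 consumes one of the two copies of e^x / (32 |z|^2) just
    obtained.\<close>
  moreover have "2 \<le> exp x / (32 * norm z ^ 2)"
  proof (subst pos_le_divide_eq)
    show "2 * (32 * norm z ^ 2) \<le> exp x"
      using b(4) zero_le_power2[of "norm z"] unfolding x_def by linarith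
  qed (use z0 in auto)
  ultimately show ?thesis using 2 unfolding x_def by linarith
qed

section \<open>The eigenvalue shift as a fixed point\<close>

lemma powser_in_Reals:
  fixes c :: "nat \<Rightarrow> complex"
  assumes "\<And>n. c n \<in> \<real>" "x \<in> \<real>" "summable (\<lambda>n. c n * x ^ n)"
  shows "(\<Sum>n. c n * x ^ n) \<in> \<real>"
proof (rule Lim_in_closed_set[OF closed_complex_Reals])
  show "(\<lambda>N. \<Sum>n<N. c n * x ^ n) \<longlonglongrightarrow> (\<Sum>n. c n * x ^ n)"
    using assms(3) by (rule summable_LIMSEQ)
qed (use assms in \<open>auto intro!: always_eventually sum_in_Reals Reals_mult Reals_power\<close>)

lemma osc_coeff_in_Reals: "z \<in> \<real> \<Longrightarrow> d \<in> \<real> \<Longrightarrow> osc_coeff z d n \<in> \<real>"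
  by (induction n)
     (auto intro!: Reals_divide Reals_mult Reals_add Reals_diff
           simp del: of_nat_mult of_nat_add of_nat_Suc)

lemma osc_in_Reals:
  assumes "z \<in> \<real>" "d \<in> \<real>" "s \<in> \<real>"
  shows "osc z d s \<in> \<real>" "osc' z d s \<in> \<real>"
proof -
  have "summable (\<lambda>n. diffs (osc_coeff z d) n * y ^ n)" for y
    using termdiff_converges_all[of "osc_coeff z d"] summable_osc_coeff by blast
  thus "osc' z d s \<in> \<real>"
    unfolding osc'_def diffs_def
    using assms by (auto intro!: Reals_mult powser_in_Reals osc_coeff_in_Reals simp del: osc_coeff.simps of_nat_Suc)
  show "osc z d s \<in> \<real>"
    unfolding osc_def
    using assms summable_osc_coeff by (auto intro!: powser_in_Reals osc_coeff_in_Reals)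
qed

text \<open>A majorant: for the parameters A and -B every contribution to the recursion is
  nonnegative, so no sign is lost in the triangle inequality. It serves the Weierstrass test on
  compact sets, and with z = A real and shift 0 it shows that the coefficients are
  nonnegative.\<close>

lemma norm_osc_coeff_le:
  assumes "norm z \<le> A" "norm d \<le> B"
  shows "norm (osc_coeff z d n) \<le> Re (osc_coeff (of_real A) (- of_real B) n)"
proof (induction n)
  case (Suc n)
  define m where "m = real ((2 * n + 2) * (2 * n + 1))"
  define e where "e = (if n = 0 then 1 else 0 :: real)"
  have m: "m > 0" by (simp add: m_def del: of_nat_mult of_nat_add)
  have im: "Im (osc_coeff (of_real A) (- of_real B) k) = 0" for k
    using osc_coeff_in_Reals[of "of_real A" "- of_real B" k] by (simp add: complex_is_Real_iff)
  have S: "osc_coeff z d (Suc n)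
      = (of_real e + (4 * z * of_nat n - d) * osc_coeff z d n) / of_real m" for z d
    by (simp add: m_def e_def)
  have "norm (of_real e + (4 * z * of_nat n - d) * osc_coeff z d n)
      \<le> e + (4 * A * real n + B) * Re (osc_coeff (of_real A) (- of_real B) n)"
  proof (rule order_trans[OF norm_triangle_ineq], rule add_mono)
    have "norm (4 * z * of_nat n - d) \<le> norm (4 * z * of_nat n) + norm d"
      by (rule norm_triangle_ineq4)
    also have "\<dots> \<le> 4 * A * real n + B"
      using assms by (auto simp: norm_mult intro!: add_mono mult_right_mono)
    finally show "norm ((4 * z * of_nat n - d) * osc_coeff z d n)
        \<le> (4 * A * real n + B) * Re (osc_coeff (of_real A) (- of_real B) n)"
      unfolding norm_mult by (intro mult_mono Suc) (auto intro: order_trans[OF norm_ge_zero])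
  qed (simp add: e_def)
  also have "\<dots> = Re (of_real e + (4 * of_real A * of_nat n - (- of_real B)) * osc_coeff (of_real A) (- of_real B) n)"
    by (simp add: im)
  finally show ?case
    unfolding S using m by (simp add: norm_divide divide_right_mono del: of_real_add)
qed simp

text \<open>The shift is a function of \<open>z\<close> here, so that the statement applies directly
  to each iterate and holomorphy in two variables is avoided; the partial sums are polynomials in z
  and f(z).\<close>

lemma holomorphic_on_osc:
  assumes S: "open S" and f: "f holomorphic_on S"
  shows "(\<lambda>z. osc z (f z) 1) holomorphic_on S"
proof (rule holomorphic_uniform_sequence[OF S])
  define F where "F = (\<lambda>N z. \<Sum>n<N. osc_coeff z (f z) n)"
  have "(\<lambda>z. osc_coeff z (f z) n) holomorphic_on S" for n
    by (induction n) (auto intro!: holomorphic_intros f simp del: of_nat_mult of_nat_add of_nat_Suc)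
  thus "F N holomorphic_on S" for N
    unfolding F_def by (auto intro!: holomorphic_intros)
  fix x assume "x \<in> S"
  then obtain r where r: "r > 0" "cball x r \<subseteq> S"
    using S open_contains_cball by blast
  have "continuous_on (cball x r) f"
    using f r holomorphic_on_imp_continuous_on continuous_on_subset by blast
  hence "compact (f ` cball x r)" by (rule compact_continuous_image) simp
  then obtain B where B: "\<And>z. z \<in> cball x r \<Longrightarrow> norm (f z) \<le> B"
    using compact_imp_bounded bounded_iff by (metis imageI)
  have A: "norm z \<le> norm x + r" if "z \<in> cball x r" for z
    using that norm_triangle_ineq2[of z x] by (simp add: dist_norm norm_minus_commute)
  have "uniform_limit (cball x r) F (\<lambda>z. \<Sum>n. osc_coeff z (f z) n) sequentially"
    unfolding F_def
  proof (rule Weierstrass_m_test)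
    show "norm (osc_coeff z (f z) n) \<le> Re (osc_coeff (of_real (norm x + r)) (- of_real B) n)"
      if "z \<in> cball x r" for n z
      by (rule norm_osc_coeff_le) (use A B that in auto)
    show "summable (\<lambda>n. Re (osc_coeff (of_real (norm x + r)) (- of_real B) n))"
      using summable_osc_coeff[of _ _ 1] by (intro summable_Re) simp
  qed
  moreover have "(\<lambda>z. \<Sum>n. osc_coeff z (f z) n) = (\<lambda>z. osc z (f z) 1)"
    by (simp add: osc_def)
  ultimately show "\<exists>d>0. cball x d \<subseteq> S \<and> uniform_limit (cball x d) F (\<lambda>z. osc z (f z) 1) sequentially"
    using r by auto
qed

section \<open>The contraction and its fixed point\<close>

text \<open>Twice the reciprocal of the lower bound in \<open>norm_osc_zero_ge\<close>: the factor 2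
  leaves room for changing the shift from 0 to \<open>d\<close>.\<close>

definition shift_bound :: "complex \<Rightarrow> real" where
  "shift_bound z = 64 * norm z ^ 2 * exp (- Re z)"

text \<open>The third bound is the contraction constant: G(1) has Lipschitz constant 4 e^(Re z) in
  the shift, and inversion contributes two factors \<open>shift_bound z\<close>. It holds because 4
  * 64^2 = 16384 is below 50000 / 2.\<close>

lemma shift_bound_bounds:
  assumes "z \<in> parabolic_region"
  shows "0 < shift_bound z" "shift_bound z \<le> 1/2" "4 * exp (Re z) * shift_bound z ^ 2 \<le> 1/2"
proof -
  note b = parabolic_region_bounds[OF assms]
  have "z \<noteq> 0" using b(2) by auto
  thus "0 < shift_bound z" by (simp add: shift_bound_def)
  have "128 * norm z ^ 2 \<le> exp (Re z)" using b(4) zero_le_power2[of "norm z"] by linarith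
  thus "shift_bound z \<le> 1/2"
    by (simp add: shift_bound_def exp_minus field_simps)
  have "4 * exp (Re z) * shift_bound z ^ 2 = 16384 * norm z ^ 4 / exp (Re z)"
    by (simp add: shift_bound_def exp_minus power2_eq_square power4_eq_xxxx field_simps)
  also have "\<dots> \<le> 1/2"
  proof (subst pos_divide_le_eq)
    show "16384 * norm z ^ 4 \<le> 1/2 * exp (Re z)"
      using b(3) zero_le_power[OF norm_ge_zero[of z], of 4] by linarith
  qed simp
  finally show "4 * exp (Re z) * shift_bound z ^ 2 \<le> 1/2" .
qed

text \<open>Moving the shift within the disc uses up at most half of the lower bound at shift 0; the
  other half is exactly the reciprocal of \<open>shift_bound z\<close>, so inversion maps the disc
  into itself.\<close>

lemma norm_osc_ge:
  assumes z: "z \<in> parabolic_region" and d: "norm d \<le> shift_bound z"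
  shows "norm (osc z d 1 - osc z 0 1) \<le> exp (Re z) / (64 * norm z ^ 2)"
    "norm (osc z d 1) \<ge> 1 / shift_bound z"
proof -
  note b = parabolic_region_bounds[OF z] and sb = shift_bound_bounds[OF z]
  have "norm (osc z d 1 - osc z 0 1) \<le> 4 * norm (d - 0) * exp (Re z)"
    using norm_osc_diff_le[of z d 0 1] b sb d by simp
  also have "\<dots> \<le> 4 * shift_bound z * exp (Re z)"
    using d by simp
  also have "\<dots> = 256 * norm z ^ 2" by (simp add: shift_bound_def exp_minus)
  also have "\<dots> \<le> exp (Re z) / (64 * norm z ^ 2)"
  proof (subst pos_le_divide_eq)
    show "0 < 64 * norm z ^ 2" using b(2) by auto
    have "256 * norm z ^ 2 * (64 * norm z ^ 2) = 16384 * norm z ^ 4"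
      by (simp add: power2_eq_square power4_eq_xxxx)
    thus "256 * norm z ^ 2 * (64 * norm z ^ 2) \<le> exp (Re z)"
      using b(3) zero_le_power[OF norm_ge_zero[of z], of 4] by linarith
  qed
  finally show *: "norm (osc z d 1 - osc z 0 1) \<le> exp (Re z) / (64 * norm z ^ 2)" .
  have "norm (osc z 0 1) - norm (osc z d 1) \<le> norm (osc z d 1 - osc z 0 1)"
    by (metis norm_minus_commute norm_triangle_ineq2)
  moreover have "exp (Re z) / (32 * norm z ^ 2) = 2 * (exp (Re z) / (64 * norm z ^ 2))" by simp
  moreover have "1 / shift_bound z = exp (Re z) / (64 * norm z ^ 2)"
    by (simp add: shift_bound_def exp_minus field_simps)
  ultimately show "norm (osc z d 1) \<ge> 1 / shift_bound z"
    using * norm_osc_zero_ge[OF z] by linarith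
qed

lemma norm_inverse_osc_le:
  assumes z: "z \<in> parabolic_region" and d: "norm d \<le> shift_bound z"
  shows "osc z d 1 \<noteq> 0" "norm (inverse (osc z d 1)) \<le> shift_bound z"
proof -
  have p: "0 < 1 / shift_bound z" using shift_bound_bounds(1)[OF z] by simp
  with norm_osc_ge(2)[OF assms] show "osc z d 1 \<noteq> 0" by auto
  from le_imp_inverse_le[OF norm_osc_ge(2)[OF assms] p] show "norm (inverse (osc z d 1)) \<le> shift_bound z"
    by (simp add: norm_inverse)
qed

lemma norm_inverse_osc_diff_le:
  assumes z: "z \<in> parabolic_region" and d: "norm d \<le> shift_bound z" and e: "norm e \<le> shift_bound z"
  shows "norm (inverse (osc z d 1) - inverse (osc z e 1)) \<le> 1/2 * norm (d - e)"
proof -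
  note b = parabolic_region_bounds[OF z] and sb = shift_bound_bounds[OF z]
  note D = norm_inverse_osc_le[OF z d] and E = norm_inverse_osc_le[OF z e]
  have "norm (inverse (osc z d 1) - inverse (osc z e 1))
     = norm (osc z d 1 - osc z e 1) * (norm (inverse (osc z d 1)) * norm (inverse (osc z e 1)))"
    by (simp add: inverse_diff_inverse[OF D(1) E(1)] norm_mult)
  also have "\<dots> \<le> (4 * norm (d - e) * exp (Re z)) * (shift_bound z * shift_bound z)"
    using norm_osc_diff_le[of z d e 1] b sb d e D E by (intro mult_mono) auto
  also have "\<dots> = 4 * exp (Re z) * shift_bound z ^ 2 * norm (d - e)"
    by (simp add: power2_eq_square)
  also have "\<dots> \<le> 1/2 * norm (d - e)"
    using sb(3) by (intro mult_right_mono) auto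
  finally show ?thesis .
qed

text \<open>Starting from the constant 0, each step preserves holomorphy on the region, the disc
  bound and reality at real points; the limit inherits all three.\<close>

primrec shift_iter :: "nat \<Rightarrow> complex \<Rightarrow> complex" where
  "shift_iter 0 z = 0"
| "shift_iter (Suc n) z = inverse (osc z (shift_iter n z) 1)"

lemma norm_shift_iter_le: "z \<in> parabolic_region \<Longrightarrow> norm (shift_iter n z) \<le> shift_bound z"
  by (induction n) (auto intro: norm_inverse_osc_le(2) less_imp_le shift_bound_bounds(1))

lemma norm_shift_iter_diff_le:
  assumes z: "z \<in> parabolic_region"
  shows "norm (shift_iter (Suc n) z - shift_iter n z) \<le> (1/2) ^ n"
proof (induction n)
  case 0
  show ?case using norm_shift_iter_le[OF z, of 1] shift_bound_bounds[OF z] by simp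
next
  case (Suc n)
  show ?case
    using norm_inverse_osc_diff_le[OF z norm_shift_iter_le[OF z] norm_shift_iter_le[OF z], of "Suc n" n] Suc
    by simp
qed

lemma open_parabolic_region: "open parabolic_region"
proof -
  have "parabolic_region = {z. 0 < Re z} \<inter> {z. 1000 * norm z < (Re z)\<^sup>2}"
    by (auto simp: parabolic_region_def)
  moreover have "open {z. 0 < Re z}" "open {z. 1000 * norm z < (Re z)\<^sup>2}"
    by (intro open_Collect_less continuous_intros)+
  ultimately show ?thesis by (metis open_Int)
qed

lemma shift_iter_holomorphic: "shift_iter n holomorphic_on parabolic_region"
proof (induction n)
  case (Suc n)
  have "(\<lambda>z. inverse (osc z (shift_iter n z) 1)) holomorphic_on parabolic_region"
    using norm_inverse_osc_le(1) norm_shift_iter_le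
    by (intro holomorphic_intros holomorphic_on_osc open_parabolic_region Suc) blast
  thus ?case by simp
qed simp

text \<open>The limit of the iteration, written as a telescoping series so that the geometric bound
  on the increments gives uniform convergence on the whole region.\<close>

definition eigenvalue_shift :: "complex \<Rightarrow> complex" where
  "eigenvalue_shift z = (\<Sum>n. shift_iter (Suc n) z - shift_iter n z)"

lemma uniform_limit_shift_iter:
  "uniform_limit parabolic_region shift_iter eigenvalue_shift sequentially"
proof -
  have "uniform_limit parabolic_region (\<lambda>N z. \<Sum>n<N. shift_iter (Suc n) z - shift_iter n z)
          (\<lambda>z. \<Sum>n. shift_iter (Suc n) z - shift_iter n z) sequentially"
  proof (rule Weierstrass_m_test)
    show "summable (\<lambda>n. (1/2 :: real) ^ n)" by (rule summable_geometric) simp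
  qed (rule norm_shift_iter_diff_le)
  moreover have "(\<lambda>N z. \<Sum>n<N. shift_iter (Suc n) z - shift_iter n z) = shift_iter"
  proof (intro ext)
    show "(\<Sum>n<N. shift_iter (Suc n) z - shift_iter n z) = shift_iter N z" for N z
      using sum_lessThan_telescope[of "\<lambda>n. shift_iter n z" N] by (simp only: shift_iter.simps(1) diff_zero)
  qed
  ultimately show ?thesis by (simp add: eigenvalue_shift_def[abs_def])
qed

lemma shift_iter_LIMSEQ:
  "z \<in> parabolic_region \<Longrightarrow> (\<lambda>n. shift_iter n z) \<longlonglongrightarrow> eigenvalue_shift z"
  using tendsto_uniform_limitI[OF uniform_limit_shift_iter] .

lemma eigenvalue_shift_holomorphic: "eigenvalue_shift holomorphic_on parabolic_region"
proof (rule holomorphic_uniform_sequence[OF open_parabolic_region shift_iter_holomorphic])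
  fix x assume "x \<in> parabolic_region"
  then obtain r where "r > 0" "cball x r \<subseteq> parabolic_region"
    using open_parabolic_region open_contains_cball by blast
  thus "\<exists>d>0. cball x d \<subseteq> parabolic_region
          \<and> uniform_limit (cball x d) shift_iter eigenvalue_shift sequentially"
    using uniform_limit_on_subset[OF uniform_limit_shift_iter] by blast
qed

lemma norm_eigenvalue_shift_le:
  assumes "z \<in> parabolic_region"
  shows "norm (eigenvalue_shift z) \<le> shift_bound z"
  by (rule Lim_norm_ubound[OF _ shift_iter_LIMSEQ[OF assms]])
     (auto intro: always_eventually norm_shift_iter_le assms)

lemma eigenvalue_shift_eq:
  assumes z: "z \<in> parabolic_region"
  shows "eigenvalue_shift z * osc z (eigenvalue_shift z) 1 = 1"
proof -
  let ?e = "eigenvalue_shift z"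
  have e: "norm ?e \<le> shift_bound z" by (rule norm_eigenvalue_shift_le[OF z])
  have "(\<lambda>n. 1/2 * norm (shift_iter n z - ?e)) \<longlonglongrightarrow> 1/2 * norm (?e - ?e)"
    by (intro tendsto_intros shift_iter_LIMSEQ z)
  hence "(\<lambda>n. 1/2 * norm (shift_iter n z - ?e)) \<longlonglongrightarrow> 0" by simp
  hence "(\<lambda>n. shift_iter (Suc n) z - inverse (osc z ?e 1)) \<longlonglongrightarrow> 0"
    by (rule Lim_null_comparison[rotated])
       (use norm_inverse_osc_diff_le[OF z norm_shift_iter_le[OF z] e] in \<open>auto intro!: always_eventually\<close>)
  hence "(\<lambda>n. shift_iter (Suc n) z) \<longlonglongrightarrow> inverse (osc z ?e 1)"
    by (simp add: LIM_zero_iff)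
  moreover have "(\<lambda>n. shift_iter (Suc n) z) \<longlonglongrightarrow> ?e"
    using shift_iter_LIMSEQ[OF z] by (rule LIMSEQ_Suc)
  ultimately have "?e = inverse (osc z ?e 1)" by (rule LIMSEQ_unique[rotated])
  thus ?thesis using norm_inverse_osc_le(1)[OF z e] by (metis left_inverse)
qed

lemma eigenvalue_shift_in_Reals:
  assumes "z \<in> parabolic_region" "z \<in> \<real>"
  shows "eigenvalue_shift z \<in> \<real>"
proof (rule Lim_in_closed_set[OF closed_complex_Reals _ _ shift_iter_LIMSEQ[OF assms(1)]])
  have "shift_iter n z \<in> \<real>" for n
    by (induction n) (auto intro!: osc_in_Reals assms)
  thus "\<forall>\<^sub>F n in sequentially. shift_iter n z \<in> \<real>" by simp
qed simp

section \<open>The ground state on the real axis\<close>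

lemma of_real_in_parabolic_region: "1000 < \<alpha> \<Longrightarrow> complex_of_real \<alpha> \<in> parabolic_region"
  by (simp add: parabolic_region_def power2_eq_square)

lemma osc_minus [simp]: "osc z d (- s) = osc z d s" by (simp add: osc_def)

definition real_shift :: "real \<Rightarrow> real" where
  "real_shift \<alpha> = Re (eigenvalue_shift (of_real \<alpha>))"

lemma of_real_real_shift:
  "1000 < \<alpha> \<Longrightarrow> complex_of_real (real_shift \<alpha>) = eigenvalue_shift (of_real \<alpha>)"
  using eigenvalue_shift_in_Reals[OF of_real_in_parabolic_region]
  by (simp add: real_shift_def)

text \<open>The fixed point equation gives d the sign of G(1), so positivity of d needs the sign of
  G(1) and not only its modulus. The bound 8 d \<alpha> < 1 is what the positivity of the ground
  state uses.\<close>

lemma real_shift_bounds: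
  assumes a: "1000 < \<alpha>"
  defines "d \<equiv> real_shift \<alpha>"
  shows "0 < d" "8 * d * \<alpha> < 1" "d \<le> 1/2" and "d * Re (osc (of_real \<alpha>) (of_real d) 1) = 1"
proof -
  let ?z = "complex_of_real \<alpha>"
  have z: "?z \<in> parabolic_region" using a by (rule of_real_in_parabolic_region)
  have d: "complex_of_real d = eigenvalue_shift ?z" unfolding d_def using a by (rule of_real_real_shift)
  have nd: "\<bar>d\<bar> \<le> shift_bound ?z" using norm_eigenvalue_shift_le[OF z] by (simp flip: d)
  show "d \<le> 1/2" using nd shift_bound_bounds(2)[OF z] by linarith
  have eq: "of_real d * osc ?z (of_real d) 1 = 1" using eigenvalue_shift_eq[OF z] by (simp flip: d)
  hence "Re (of_real d * osc ?z (of_real d) 1) = 1" by simp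
  thus e: "d * Re (osc ?z (of_real d) 1) = 1" by simp
  \<comment> \<open>At shift 0 all coefficients are nonnegative and the one with index 1 equals
    1/2.\<close>
  have "1/2 \<le> (\<Sum>n. Re (osc_coeff ?z 0 n))"
  proof -
    have "summable (\<lambda>n. Re (osc_coeff ?z 0 n))"
      using summable_osc_coeff[of _ _ 1] by (intro summable_Re) simp
    moreover have "0 \<le> Re (osc_coeff ?z 0 n)" for n
      using norm_osc_coeff_le[of ?z \<alpha> 0 0 n] a order_trans[OF norm_ge_zero] by simp
    ultimately have "(\<Sum>n<2. Re (osc_coeff ?z 0 n)) \<le> (\<Sum>n. Re (osc_coeff ?z 0 n))"
      by (intro sum_le_suminf) auto
    thus ?thesis by (simp add: numeral_2_eq_2)
  qed
  also have "\<dots> = Re (osc ?z 0 1)"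
    using summable_osc_coeff[of _ _ 1] by (simp add: osc_def Re_suminf)
  finally have p: "0 < Re (osc ?z 0 1)" by simp
  have "osc ?z 0 1 \<in> \<real>" by (rule osc_in_Reals) auto
  hence "norm (osc ?z 0 1) = Re (osc ?z 0 1)" using p
    by (auto elim!: Reals_cases)
  hence "exp \<alpha> / (32 * \<alpha> ^ 2) \<le> Re (osc ?z 0 1)"
    using norm_osc_zero_ge[OF z] by simp
  moreover have "Re (osc ?z 0 1) - Re (osc ?z (of_real d) 1) \<le> exp \<alpha> / (64 * \<alpha> ^ 2)"
    using order_trans[OF abs_Re_le_cmod norm_osc_ge(1)[OF z, of "of_real d"]] nd by simp
  moreover have "exp \<alpha> / (32 * \<alpha> ^ 2) = 2 * (exp \<alpha> / (64 * \<alpha> ^ 2))" by simp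
  moreover have "0 < exp \<alpha> / (64 * \<alpha> ^ 2)" using a by simp
  ultimately have "0 < Re (osc ?z (of_real d) 1)" by linarith
  thus d0: "0 < d" using e by (metis zero_less_mult_pos2 zero_less_one)
  have "8 * d * \<alpha> \<le> 8 * shift_bound ?z * \<alpha>"
    using nd a by simp
  also have "\<dots> = 512 * \<alpha> ^ 3 * exp (- \<alpha>)"
    using a by (simp add: shift_bound_def power2_eq_square power3_eq_cube)
  also have "\<dots> < 50000 * \<alpha> ^ 4 * exp (- \<alpha>)"
  proof (rule mult_strict_right_mono)
    have "512 * \<alpha> ^ 3 < (50000 * \<alpha>) * \<alpha> ^ 3"
      using a by (intro mult_strict_right_mono) auto
    thus "512 * \<alpha> ^ 3 < 50000 * \<alpha> ^ 4" by (simp add: power4_eq_xxxx power3_eq_cube)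
  qed simp
  also have "\<dots> \<le> exp \<alpha> * exp (- \<alpha>)"
    using parabolic_region_bounds(3)[OF z] a by (intro mult_right_mono) auto
  finally show "8 * d * \<alpha> < 1" by (simp add: exp_minus)
qed

section \<open>Positivity of the ground state\<close>

text \<open>A concave function lies above its chord: the mean value theorem on [0,s] and on [s,1]
  compares the two slopes.\<close>

lemma chord_le_of_antitone_derivative:
  fixes f :: "real \<Rightarrow> real"
  assumes "f 0 = 0" and d: "\<And>s. (f has_real_derivative f' s) (at s)"
    and anti: "\<And>s t. 0 < s \<Longrightarrow> s < t \<Longrightarrow> f' t \<le> f' s" and s: "0 < s" "s < 1"
  shows "s * f 1 \<le> f s"
proof -
  obtain u where u: "0 < u" "u < s" "f s - f 0 = (s - 0) * f' u"
    using MVT2[of 0 s f f'] s d by blast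
  obtain t where t: "s < t" "t < 1" "f 1 - f s = (1 - s) * f' t"
    using MVT2[of s 1 f f'] s d by blast
  have "f 1 - f s \<le> (1 - s) * f' u"
    unfolding t(3) using anti[of u t] u t s by (intro mult_left_mono) auto
  hence "s * (f 1 - f s) \<le> s * ((1 - s) * f' u)"
    using s by (intro mult_left_mono) auto
  also have "\<dots> = (1 - s) * f s" using u(3) assms(1) by simp
  finally show ?thesis by (simp add: algebra_simps)
qed

text \<open>Since d G(1) = 1 and G is even, it suffices that G increases on (0,1). The derivative of
  G' e^(-\<alpha> s^2) is at least e^(-\<alpha> s^2) - 2 d, so this weighted derivative is at least
  E(s) - 2 d s, with E the integral of the Gaussian. Concavity gives E(s) \<ge> s E(1), and E(1)
  \<ge> 1 / (4 \<alpha>) > 2 d.\<close>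

lemma ground_factor_pos:
  assumes a: "1000 < \<alpha>" and s: "-1 < s" "s < 1"
  defines "d \<equiv> real_shift \<alpha>"
  shows "0 < 1 - d * Re (osc (of_real \<alpha>) (of_real d) (of_real s))"
proof -
  let ?z = "complex_of_real \<alpha>"
  let ?d = "complex_of_real d"
  have z: "?z \<in> parabolic_region" using a by (rule of_real_in_parabolic_region)
  note d = real_shift_bounds[OF a, folded d_def]
  define E where "E = (\<lambda>s. Re (gauss_int ?z s))"
  have dE: "(E has_real_derivative exp (- \<alpha> * s\<^sup>2)) (at s)" for s
    using bounded_linear.has_vector_derivative[OF bounded_linear_Re gauss_int_has_vector_derivative[of ?z s UNIV]]
    by (simp add: E_def[abs_def] has_real_derivative_iff_has_vector_derivative Re_exp Re_power2 flip: of_real_power)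
  have E1: "2 * d < E 1"
  proof -
    have "1 \<le> 4 * \<alpha> * E 1" using Re_gauss_int_ge_quarter[OF z] by (simp add: E_def)
    hence "\<alpha> * (8 * d) < \<alpha> * (4 * E 1)" using d(2) by (simp add: mult_ac)
    hence "8 * d < 4 * E 1" using a by simp
    thus ?thesis by simp
  qed
  have Es: "2 * d * s < E s" if "0 < s" "s < 1" for s
  proof -
    have "s * E 1 \<le> E s"
      by (rule chord_le_of_antitone_derivative[OF _ dE _ that])
         (use a in \<open>auto simp: E_def intro!: mult_left_mono power_mono\<close>)
    moreover have "s * (2 * d) < s * E 1" using that E1 by simp
    ultimately show ?thesis by (simp add: mult_ac)
  qed
  define w where "w = (\<lambda>s::real. Re (osc' ?z ?d (of_real s) * exp (- ?z * (of_real s)\<^sup>2)))"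
  define k where "k = (\<lambda>s::real. Re ((1 - ?d * osc ?z ?d (of_real s)) * exp (- ?z * (of_real s)\<^sup>2)))"
  have dw: "(w has_real_derivative k s) (at s)" for s
    using bounded_linear.has_vector_derivative[OF bounded_linear_Re
        gauss_weighted_derivative[OF osc'_has_vector_derivative[of ?z ?d s]]]
    unfolding w_def k_def has_real_derivative_iff_has_vector_derivative .
  have k: "exp (- \<alpha> * s\<^sup>2) - 2 * d \<le> k s" if "0 \<le> s" "s \<le> 1" for s
  proof -
    define x where "x = ?d * osc ?z ?d (of_real s) * exp (- ?z * (of_real s)\<^sup>2)"
    have "norm x = d * norm (osc ?z ?d (of_real s)) * exp (- \<alpha> * s\<^sup>2)"
      using d(1) unfolding x_def norm_mult norm_exp_gauss by simp
    also have "\<dots> \<le> d * (2 * exp (\<alpha> * s\<^sup>2)) * exp (- \<alpha> * s\<^sup>2)"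
      using norm_osc_le[of ?z ?d s] d a that by (intro mult_right_mono mult_left_mono) auto
    also have "\<dots> = 2 * d" by (simp add: exp_minus)
    finally have "Re x \<le> 2 * d" using complex_Re_le_cmod[of x] by linarith
    moreover have "k s = exp (- \<alpha> * s\<^sup>2) - Re x"
      by (simp add: k_def x_def left_diff_distrib Re_exp Re_power2 flip: of_real_power)
    ultimately show ?thesis by simp
  qed
  have w: "0 < w s" if s: "0 < s" "s < 1" for s
  proof -
    have "w 0 - (E 0 - 2 * d * 0) \<le> w s - (E s - 2 * d * s)"
    proof (rule DERIV_nonneg_imp_nondecreasing[of 0 s "\<lambda>s. w s - (E s - 2 * d * s)"])
      fix t assume t: "0 \<le> t" "t \<le> s"
      have "((\<lambda>s. w s - (E s - 2 * d * s)) has_real_derivative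
               k t - (exp (- \<alpha> * t\<^sup>2) - 2 * d)) (at t)"
        by (rule derivative_eq_intros dw dE refl | simp)+
      moreover have "0 \<le> k t - (exp (- \<alpha> * t\<^sup>2) - 2 * d)" using k[of t] t s by simp
      ultimately show "\<exists>y. ((\<lambda>s. w s - (E s - 2 * d * s)) has_real_derivative y) (at t) \<and> 0 \<le> y"
        by blast
    qed (use s in simp)
    thus ?thesis using Es[OF s] by (simp add: w_def E_def)
  qed
  define G where "G = (\<lambda>s::real. Re (osc ?z ?d (of_real s)))"
  have dG: "(G has_real_derivative Re (osc' ?z ?d (of_real s))) (at s)" for s
    using bounded_linear.has_vector_derivative[OF bounded_linear_Re osc_has_vector_derivative]
    by (simp add: G_def[abs_def] has_real_derivative_iff_has_vector_derivative)
  have G': "0 < Re (osc' ?z ?d (of_real s))" if "0 < s" "s < 1" for s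
  proof -
    have "exp (- ?z * (of_real s)\<^sup>2) = of_real (exp (- \<alpha> * s\<^sup>2))"
      by (simp add: exp_of_real flip: of_real_power of_real_mult of_real_minus)
    hence "w s = Re (osc' ?z ?d (of_real s)) * exp (- \<alpha> * s\<^sup>2)"
      unfolding w_def by simp
    thus ?thesis using w[OF that] by (simp add: zero_less_mult_iff)
  qed
  have "G \<bar>s\<bar> < G 1"
  proof (rule DERIV_pos_imp_increasing_open[where f = G])
    show "\<exists>y. (G has_real_derivative y) (at x) \<and> 0 < y" if "\<bar>s\<bar> < x" "x < 1" for x
      using dG[of x] G'[of x] that by (intro exI[of _ "Re (osc' ?z ?d (of_real x))"]) auto
    show "continuous_on {\<bar>s\<bar>..1} G"
      by (meson dG DERIV_isCont continuous_at_imp_continuous_on)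
  qed (use s in auto)
  hence "d * G \<bar>s\<bar> < d * G 1" using d(1) by simp
  also have "\<dots> = 1" using d(4) by (simp add: G_def)
  also have "G \<bar>s\<bar> = G s" by (cases "s \<ge> 0") (auto simp: G_def)
  finally show ?thesis by (simp add: G_def)
qed

text \<open>Defined on the complex plane because membership in \<open>H10 I\<close> is shown by
  cut-offs whose higher derivatives come for free when the function is entire.\<close>

definition ground_state :: "complex \<Rightarrow> complex \<Rightarrow> complex \<Rightarrow> complex" where
  "ground_state z d x = exp (- z * x\<^sup>2 / 2) * (1 - d * osc z d x)"

definition ground_state' :: "complex \<Rightarrow> complex \<Rightarrow> complex \<Rightarrow> complex" where
  "ground_state' z d x = exp (- z * x\<^sup>2 / 2) * (- z * x * (1 - d * osc z d x) - d * osc' z d x)"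

lemma ground_state_DERIV:
  "(ground_state z d has_field_derivative ground_state' z d x) (at x)"
  unfolding ground_state_def[abs_def] ground_state'_def
  by (rule derivative_eq_intros osc_DERIV refl | simp)+ (simp add: algebra_simps)

lemma ground_state'_DERIV:
  "(ground_state' z d has_field_derivative ((z * x)\<^sup>2 - (z + d)) * ground_state z d x) (at x)"
  unfolding ground_state_def ground_state'_def[abs_def]
  by (rule derivative_eq_intros osc_DERIV osc'_DERIV refl | simp)+
     (simp add: algebra_simps power2_eq_square)

section \<open>Convergence in \<open>L\<^sup>2\<close>\<close>

lemma continuous_integrable_I:
  fixes f :: "real \<Rightarrow> 'b::euclidean_space"
  assumes "continuous_on {-1..1} f"
  shows "integrable (lebesgue_on I) f"
    and "integral\<^sup>L (lebesgue_on I) f = integral {-1..1} f"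
proof -
  have "f absolutely_integrable_on {-1<..<1}"
    using absolutely_integrable_continuous_real[OF assms] absolutely_integrable_on_Icc_iff_Ioo by blast
  thus i: "integrable (lebesgue_on I) f"
    by (simp add: integrable_restrict_space set_integrable_def)
  show "integral\<^sup>L (lebesgue_on I) f = integral {-1..1} f"
    using lebesgue_integral_eq_integral[OF i] by (simp add: integral_open_interval_real)
qed

lemma
  assumes "f \<in> L2 \<Omega>"
  shows L2_measurable: "f \<in> borel_measurable (lebesgue_on \<Omega>)"
    and L2_integrable_square: "integrable (lebesgue_on \<Omega>) (\<lambda>x. (cmod (f x))\<^sup>2)"
  using assms by (auto simp: L2_def)

lemma continuous_in_L2_I:
  assumes "continuous_on {-1..1} f"
  shows "f \<in> L2 I"
proof -
  have "f \<in> borel_measurable (lebesgue_on I)"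
    by (rule borel_measurable_integrable) (rule continuous_integrable_I(1)[OF assms])
  moreover have "integrable (lebesgue_on I) (\<lambda>x. (cmod (f x))\<^sup>2)"
    by (rule continuous_integrable_I) (intro continuous_intros assms)
  ultimately show ?thesis by (simp add: L2_def)
qed

lemma L2_mult_integrable:
  assumes "f \<in> L2 \<Omega>" "g \<in> L2 \<Omega>"
  shows "integrable (lebesgue_on \<Omega>) (\<lambda>x. f x * g x)"
proof (rule Bochner_Integration.integrable_bound)
  show "integrable (lebesgue_on \<Omega>) (\<lambda>x. (cmod (f x))\<^sup>2 + (cmod (g x))\<^sup>2)"
    using assms L2_integrable_square by auto
  show "(\<lambda>x. f x * g x) \<in> borel_measurable (lebesgue_on \<Omega>)"
    using assms L2_measurable by auto
  show "AE x in lebesgue_on \<Omega>. norm (f x * g x) \<le> norm ((cmod (f x))\<^sup>2 + (cmod (g x))\<^sup>2)"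
  proof (rule AE_I2)
    fix x
    have "2 * (cmod (f x) * cmod (g x)) \<le> (cmod (f x))\<^sup>2 + (cmod (g x))\<^sup>2"
      using zero_le_power2[of "cmod (f x) - cmod (g x)"] by (simp add: power2_diff)
    moreover have "0 \<le> cmod (f x) * cmod (g x)" by simp
    ultimately have "cmod (f x) * cmod (g x) \<le> (cmod (f x))\<^sup>2 + (cmod (g x))\<^sup>2" by linarith
    thus "norm (f x * g x) \<le> norm ((cmod (f x))\<^sup>2 + (cmod (g x))\<^sup>2)"
      by (simp add: norm_mult)
  qed
qed

lemma L2_cnj: "f \<in> L2 \<Omega> \<Longrightarrow> (\<lambda>x. cnj (f x)) \<in> L2 \<Omega>"
  by (auto simp: L2_def intro: borel_measurable_continuous_on[OF continuous_on_cnj[OF continuous_on_id]])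

lemma L2_bounded_mult:
  assumes f: "f \<in> L2 \<Omega>" and c: "c \<in> borel_measurable (lebesgue_on \<Omega>)"
    and b: "\<And>x. x \<in> \<Omega> \<Longrightarrow> cmod (c x) \<le> C" and \<Omega>: "\<Omega> \<in> sets lebesgue"
  shows "(\<lambda>x. c x * f x) \<in> L2 \<Omega>"
proof -
  have m: "(\<lambda>x. c x * f x) \<in> borel_measurable (lebesgue_on \<Omega>)"
    using c L2_measurable[OF f] by auto
  have "integrable (lebesgue_on \<Omega>) (\<lambda>x. (cmod (c x * f x))\<^sup>2)"
  proof (rule Bochner_Integration.integrable_bound)
    show "integrable (lebesgue_on \<Omega>) (\<lambda>x. C\<^sup>2 * (cmod (f x))\<^sup>2)"
      using L2_integrable_square[OF f] by simp
    show "(\<lambda>x. (cmod (c x * f x))\<^sup>2) \<in> borel_measurable (lebesgue_on \<Omega>)"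
      using m by auto
    show "AE x in lebesgue_on \<Omega>. norm ((cmod (c x * f x))\<^sup>2) \<le> norm (C\<^sup>2 * (cmod (f x))\<^sup>2)"
      using b by (intro AE_I2) (auto simp: norm_mult power_mult_distrib space_restrict_space
          intro!: mult_right_mono power_mono)
  qed
  with m show ?thesis by (simp add: L2_def)
qed

lemma L2_diff:
  assumes f: "f \<in> L2 \<Omega>" and g: "g \<in> L2 \<Omega>"
  shows "(\<lambda>x. f x - g x) \<in> L2 \<Omega>"
proof -
  have m: "(\<lambda>x. f x - g x) \<in> borel_measurable (lebesgue_on \<Omega>)"
    using assms L2_measurable by auto
  have "integrable (lebesgue_on \<Omega>) (\<lambda>x. (cmod (f x - g x))\<^sup>2)"
  proof (rule Bochner_Integration.integrable_bound)
    show "integrable (lebesgue_on \<Omega>) (\<lambda>x. 2 * (cmod (f x))\<^sup>2 + 2 * (cmod (g x))\<^sup>2)"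
      using assms L2_integrable_square by auto
    show "(\<lambda>x. (cmod (f x - g x))\<^sup>2) \<in> borel_measurable (lebesgue_on \<Omega>)"
      using m by auto
    show "AE x in lebesgue_on \<Omega>. norm ((cmod (f x - g x))\<^sup>2)
            \<le> norm (2 * (cmod (f x))\<^sup>2 + 2 * (cmod (g x))\<^sup>2)"
    proof (rule AE_I2)
      fix x
      have "(cmod (f x - g x))\<^sup>2 \<le> (cmod (f x) + cmod (g x))\<^sup>2"
        by (intro power_mono norm_triangle_ineq4) simp
      also have "\<dots> \<le> 2 * (cmod (f x))\<^sup>2 + 2 * (cmod (g x))\<^sup>2"
        using zero_le_power2[of "cmod (f x) - cmod (g x)"] by (simp add: power2_diff power2_sum)
      finally show "norm ((cmod (f x - g x))\<^sup>2) \<le> norm (2 * (cmod (f x))\<^sup>2 + 2 * (cmod (g x))\<^sup>2)"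
        by simp
    qed
  qed
  with m show ?thesis by (simp add: L2_def)
qed

lemma L2_Cauchy_Schwarz:
  assumes f: "f \<in> L2 \<Omega>" and g: "g \<in> L2 \<Omega>"
  shows "(cmod (LINT x|lebesgue_on \<Omega>. f x * g x))\<^sup>2
      \<le> (LINT x|lebesgue_on \<Omega>. (cmod (f x))\<^sup>2) * (LINT x|lebesgue_on \<Omega>. (cmod (g x))\<^sup>2)"
proof -
  define a where "a = (LINT x|lebesgue_on \<Omega>. (cmod (f x))\<^sup>2)"
  define b where "b = (LINT x|lebesgue_on \<Omega>. (cmod (g x))\<^sup>2)"
  define c where "c = (LINT x|lebesgue_on \<Omega>. cmod (f x) * cmod (g x))"
  have ic: "integrable (lebesgue_on \<Omega>) (\<lambda>x. cmod (f x) * cmod (g x))"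
    using integrable_norm[OF L2_mult_integrable[OF f g]] by (simp add: norm_mult)
  note i = ic L2_integrable_square[OF f] L2_integrable_square[OF g]
  have q: "0 \<le> a - 2 * t * c + t\<^sup>2 * b" for t
  proof -
    have "0 \<le> (LINT x|lebesgue_on \<Omega>. (cmod (f x) - t * cmod (g x))\<^sup>2)" by simp
    also have "\<dots> = (LINT x|lebesgue_on \<Omega>. (cmod (f x))\<^sup>2 - (2 * t) * (cmod (f x) * cmod (g x))
                        + t\<^sup>2 * (cmod (g x))\<^sup>2)"
      by (rule Bochner_Integration.integral_cong) (auto simp: power2_eq_square algebra_simps)
    also have "\<dots> = a - 2 * t * c + t\<^sup>2 * b"
      unfolding a_def b_def c_def using i
      by (subst Bochner_Integration.integral_add Bochner_Integration.integral_diff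
            integral_mult_right_zero | auto)+
    finally show ?thesis .
  qed
  have pos: "0 \<le> b" "0 \<le> c" by (auto simp: b_def c_def)
  have "c\<^sup>2 \<le> a * b"
  proof (cases "b = 0")
    case True
    have "c \<le> 0"
    proof (rule ccontr)
      assume "\<not> c \<le> 0"
      hence c: "c > 0" by simp
      \<comment> \<open>For b = 0 the quadratic degenerates to a - 2 t c, and this t gives it the
        value -1.\<close>
      have "0 \<le> a - 2 * ((a + 1) / (2 * c)) * c" using q[of "(a + 1) / (2 * c)"] True by simp
      thus False using c by simp
    qed
    with pos True show ?thesis by simp
  next
    case False
    hence b: "b > 0" using pos by simp
    have "0 \<le> a - 2 * (c / b) * c + (c / b)\<^sup>2 * b" by (rule q)
    also have "\<dots> = a - c\<^sup>2 / b" using b by (simp add: field_simps power2_eq_square)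
    finally show ?thesis using b by (simp add: field_simps)
  qed
  moreover have "(cmod (LINT x|lebesgue_on \<Omega>. f x * g x))\<^sup>2 \<le> c\<^sup>2"
    using integral_norm_bound[of "lebesgue_on \<Omega>" "\<lambda>x. f x * g x"]
    by (intro power_mono) (auto simp: c_def norm_mult)
  ultimately show ?thesis unfolding a_def b_def by linarith
qed

lemma L2_tendsto_integral_mult:
  assumes f: "f \<in> L2 \<Omega>" and fn: "\<And>n. F n \<in> L2 \<Omega>" and g: "g \<in> L2 \<Omega>"
    and lim: "(\<lambda>n. LINT x|lebesgue_on \<Omega>. (cmod (f x - F n x))\<^sup>2) \<longlonglongrightarrow> 0"
  shows "(\<lambda>n. LINT x|lebesgue_on \<Omega>. F n x * g x) \<longlonglongrightarrow> (LINT x|lebesgue_on \<Omega>. f x * g x)"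
proof -
  have "(\<lambda>n. (cmod (LINT x|lebesgue_on \<Omega>. (f x - F n x) * g x))\<^sup>2) \<longlonglongrightarrow> 0"
  proof (rule Lim_null_comparison)
    show "(\<lambda>n. (LINT x|lebesgue_on \<Omega>. (cmod (f x - F n x))\<^sup>2)
            * (LINT x|lebesgue_on \<Omega>. (cmod (g x))\<^sup>2)) \<longlonglongrightarrow> 0"
      using tendsto_mult_right[OF lim] by simp
    show "\<forall>\<^sub>F n in sequentially. norm ((cmod (LINT x|lebesgue_on \<Omega>. (f x - F n x) * g x))\<^sup>2)
        \<le> (LINT x|lebesgue_on \<Omega>. (cmod (f x - F n x))\<^sup>2) * (LINT x|lebesgue_on \<Omega>. (cmod (g x))\<^sup>2)"
      using L2_Cauchy_Schwarz[OF L2_diff[OF f fn] g] by (intro always_eventually) auto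
  qed
  hence "(\<lambda>n. LINT x|lebesgue_on \<Omega>. (f x - F n x) * g x) \<longlonglongrightarrow> 0"
    by (simp add: tendsto_norm_zero_iff)
  moreover have "(LINT x|lebesgue_on \<Omega>. (f x - F n x) * g x)
      = (LINT x|lebesgue_on \<Omega>. f x * g x) - (LINT x|lebesgue_on \<Omega>. F n x * g x)" for n
    using L2_mult_integrable[OF f g] L2_mult_integrable[OF fn g] by (simp add: left_diff_distrib)
  ultimately have "(\<lambda>n. (LINT x|lebesgue_on \<Omega>. f x * g x)
      - ((LINT x|lebesgue_on \<Omega>. f x * g x) - (LINT x|lebesgue_on \<Omega>. F n x * g x)))
      \<longlonglongrightarrow> (LINT x|lebesgue_on \<Omega>. f x * g x) - 0"
    by (intro tendsto_diff tendsto_const) simp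
  thus ?thesis by simp
qed

text \<open>The identity |F|^2 = |f - F|^2 + 2 Re(F cnj f) - |f|^2 reduces the claim to norm
  convergence and to pairing with a fixed function. The weight may change sign, as (\<alpha> x)^2 -
  \<mu> does.\<close>

lemma L2_tendsto_weighted_square:
  fixes c :: "real \<Rightarrow> real"
  assumes f: "f \<in> L2 \<Omega>" and fn: "\<And>n. F n \<in> L2 \<Omega>"
    and c: "c \<in> borel_measurable (lebesgue_on \<Omega>)" and b: "\<And>x. x \<in> \<Omega> \<Longrightarrow> \<bar>c x\<bar> \<le> C"
    and \<Omega>: "\<Omega> \<in> sets lebesgue"
    and lim: "(\<lambda>n. LINT x|lebesgue_on \<Omega>. (cmod (f x - F n x))\<^sup>2) \<longlonglongrightarrow> 0"
  shows "(\<lambda>n. LINT x|lebesgue_on \<Omega>. c x * (cmod (F n x))\<^sup>2)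
           \<longlonglongrightarrow> (LINT x|lebesgue_on \<Omega>. c x * (cmod (f x))\<^sup>2)"
proof -
  let ?L = "lebesgue_on \<Omega>"
  have cc: "(\<lambda>x. complex_of_real (c x)) \<in> borel_measurable ?L" using c by auto
  have W: "(\<lambda>x. of_real (c x) * g x) \<in> L2 \<Omega>" if "g \<in> L2 \<Omega>" for g
    by (rule L2_bounded_mult[OF that cc _ \<Omega>]) (use b in auto)
  have Wi: "integrable ?L (\<lambda>x. c x * (cmod (g x))\<^sup>2)" if "g \<in> L2 \<Omega>" for g
  proof -
    have "integrable ?L (\<lambda>x. Re (of_real (c x) * g x * cnj (g x)))"
      by (intro integrable_Re L2_mult_integrable W L2_cnj that)
    moreover have "Re (of_real (c x) * g x * cnj (g x)) = c x * (cmod (g x))\<^sup>2" for x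
      unfolding cmod_power2 by (simp add: algebra_simps power2_eq_square)
    ultimately show ?thesis by simp
  qed
  define h where "h = (\<lambda>x. of_real (c x) * cnj (f x))"
  have h: "h \<in> L2 \<Omega>" unfolding h_def by (intro W L2_cnj f)
  have l1: "(\<lambda>n. LINT x|?L. c x * (cmod (f x - F n x))\<^sup>2) \<longlonglongrightarrow> 0"
  proof (rule Lim_null_comparison)
    show "(\<lambda>n. C * (LINT x|?L. (cmod (f x - F n x))\<^sup>2)) \<longlonglongrightarrow> 0"
      using tendsto_mult_left[OF lim] by simp
    have "\<bar>LINT x|?L. c x * (cmod (f x - F n x))\<^sup>2\<bar> \<le> (LINT x|?L. C * (cmod (f x - F n x))\<^sup>2)" for n
    proof -
      have "\<bar>LINT x|?L. c x * (cmod (f x - F n x))\<^sup>2\<bar> \<le> (LINT x|?L. \<bar>c x * (cmod (f x - F n x))\<^sup>2\<bar>)"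
        by (rule integral_abs_bound)
      also have "\<dots> \<le> (LINT x|?L. C * (cmod (f x - F n x))\<^sup>2)"
        using Wi[OF L2_diff[OF f fn]] L2_integrable_square[OF L2_diff[OF f fn]] b
        by (intro integral_mono integrable_abs)
           (auto simp: abs_mult space_restrict_space intro!: mult_right_mono)
      finally show ?thesis .
    qed
    thus "\<forall>\<^sub>F n in sequentially. norm (LINT x|?L. c x * (cmod (f x - F n x))\<^sup>2)
            \<le> C * (LINT x|?L. (cmod (f x - F n x))\<^sup>2)"
      by (intro always_eventually) simp
  qed
  have l2: "(\<lambda>n. Re (LINT x|?L. F n x * h x)) \<longlonglongrightarrow> Re (LINT x|?L. f x * h x)"
    by (intro tendsto_Re L2_tendsto_integral_mult[OF f fn h lim])
  have e: "(LINT x|?L. c x * (cmod (F n x))\<^sup>2)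
      = (LINT x|?L. c x * (cmod (f x - F n x))\<^sup>2) + 2 * Re (LINT x|?L. F n x * h x)
        - Re (LINT x|?L. f x * h x)" for n
  proof -
    have i: "integrable ?L (\<lambda>x. F n x * h x)" "integrable ?L (\<lambda>x. f x * h x)"
      by (intro L2_mult_integrable h fn f)+
    have "c x * (cmod (F n x))\<^sup>2 = c x * (cmod (f x - F n x))\<^sup>2 + 2 * Re (F n x * h x) - Re (f x * h x)" for x
      unfolding h_def cmod_power2 by (simp add: algebra_simps power2_eq_square)
    hence "(LINT x|?L. c x * (cmod (F n x))\<^sup>2)
       = (LINT x|?L. c x * (cmod (f x - F n x))\<^sup>2 + 2 * Re (F n x * h x) - Re (f x * h x))" by simp
    also have "\<dots> = (LINT x|?L. c x * (cmod (f x - F n x))\<^sup>2) + 2 * (LINT x|?L. Re (F n x * h x))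
        - (LINT x|?L. Re (f x * h x))"
      using i Wi[OF L2_diff[OF f fn]] by (simp del: times_complex.sel)
    finally show ?thesis using i by (simp del: times_complex.sel)
  qed
  have "Re (LINT x|?L. f x * h x) = (LINT x|?L. Re (f x * h x))"
    using L2_mult_integrable[OF f h] by (simp del: times_complex.sel)
  also have "\<dots> = (LINT x|?L. c x * (cmod (f x))\<^sup>2)"
    by (rule Bochner_Integration.integral_cong)
       (unfold h_def cmod_power2, auto simp: algebra_simps power2_eq_square)
  finally have "Re (LINT x|?L. f x * h x) = (LINT x|?L. c x * (cmod (f x))\<^sup>2)" .
  moreover have "(\<lambda>n. (LINT x|?L. c x * (cmod (f x - F n x))\<^sup>2) + 2 * Re (LINT x|?L. F n x * h x)
        - Re (LINT x|?L. f x * h x)) \<longlonglongrightarrow> 0 + 2 * Re (LINT x|?L. f x * h x) - Re (LINT x|?L. f x * h x)"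
    by (intro tendsto_intros l1 l2)
  ultimately show ?thesis unfolding e by simp
qed

section \<open>Weak eigenfunctions\<close>

text \<open>The strict inequality b < 1 keeps integrations by parts away from the endpoints, where
  the logarithmic derivative of a positive solution may blow up.\<close>

lemma test_functionE:
  assumes "\<psi> \<in> test_functions I"
  obtains D b where "D 0 = \<psi>" "\<And>n x. (D n has_vector_derivative D (Suc n) x) (at x)"
    "\<And>x. dx \<psi> x = D 1 x" "0 < b" "b < 1" "\<And>n x. b \<le> \<bar>x\<bar> \<Longrightarrow> D n x = 0"
proof -
  from assms obtain D K where D: "D 0 = \<psi>" "\<And>n x. (D n has_vector_derivative D (Suc n) x) (at x)"
    and K: "compact K" "K \<subseteq> I" "\<And>x. x \<notin> K \<Longrightarrow> \<psi> x = 0"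
    unfolding test_functions_def smooth_def by blast
  have "\<exists>b>0. b < 1 \<and> (\<forall>x\<in>K. \<bar>x\<bar> < b)"
  proof (cases "K = {}")
    case False
    obtain m where m: "m \<in> K" "\<And>x. x \<in> K \<Longrightarrow> \<bar>x\<bar> \<le> \<bar>m\<bar>"
      using continuous_attains_sup[OF K(1) False continuous_on_rabs[OF continuous_on_id]] by auto
    have "m \<in> I" using m(1) K(2) by blast
    hence "\<bar>m\<bar> < 1" by auto
    with m show ?thesis by (intro exI[of _ "(1 + \<bar>m\<bar>) / 2"]) force
  qed (auto intro!: exI[of _ "1/2"])
  then obtain b where b: "b > 0" "b < 1" "\<And>x. x \<in> K \<Longrightarrow> \<bar>x\<bar> < b" by blast
  have D0: "D n x = 0" if "x \<notin> K" for n x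
    using that
  proof (induction n arbitrary: x)
    case (Suc n)
    \<comment> \<open>The complement of \<open>K\<close> is open and the previous derivative
      vanishes on it, so the derivative is that of the zero function.\<close>
    have "((\<lambda>_. 0) has_vector_derivative D (Suc n) x) (at x)"
    proof (rule has_vector_derivative_transform_within_open[OF D(2)])
      show "open (- K)" using K(1) by (simp add: compact_imp_closed open_Compl)
    qed (use Suc in auto)
    thus ?case using vector_derivative_unique_at has_vector_derivative_const by blast
  qed (use D K in auto)
  show ?thesis
  proof (rule that[OF D _ b(1,2)])
    show "dx \<psi> x = D 1 x" for x
      using D(2)[of 0] by (intro vector_derivative_at) (simp add: D(1))
    show "D n x = 0" if "b \<le> \<bar>x\<bar>" for n x
      using D0 b(3) that by force
  qed
qed

lemma test_function_dx:
  assumes "\<psi> \<in> test_functions \<Omega>"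
  shows "dx \<psi> \<in> test_functions \<Omega>"
proof -
  from assms obtain D K where D: "D 0 = \<psi>" "\<And>n x. (D n has_vector_derivative D (Suc n) x) (at x)"
    and K: "compact K" "K \<subseteq> \<Omega>" "\<And>x. x \<notin> K \<Longrightarrow> \<psi> x = 0"
    unfolding test_functions_def smooth_def by blast
  have e: "dx \<psi> = D 1"
    using D(2)[of 0] by (intro ext vector_derivative_at) (simp add: D(1))
  have "D 1 x = 0" if "x \<notin> K" for x
  proof -
    have "((\<lambda>_. 0) has_vector_derivative D 1 x) (at x)"
    proof (rule has_vector_derivative_transform_within_open)
      show "(\<psi> has_vector_derivative D 1 x) (at x)" using D(2)[of 0] by (simp add: D(1))
      show "open (- K)" using K(1) by (simp add: compact_imp_closed open_Compl)
    qed (use that K in auto)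
    thus ?thesis using vector_derivative_unique_at has_vector_derivative_const by blast
  qed
  moreover have "smooth (D 1)"
    unfolding smooth_def by (rule exI[of _ "\<lambda>n. D (Suc n)"]) (simp add: D(2))
  ultimately show ?thesis
    using K unfolding test_functions_def e by blast
qed

text \<open>The weak derivative is defined by a bilinear pairing, whereas the energy identity pairs
  with conjugates.\<close>

lemma test_function_cnj:
  assumes "\<psi> \<in> test_functions \<Omega>"
  shows "(\<lambda>x. cnj (\<psi> x)) \<in> test_functions \<Omega>" "dx (\<lambda>x. cnj (\<psi> x)) = (\<lambda>x. cnj (dx \<psi> x))"
proof -
  from assms obtain D K where D: "D 0 = \<psi>" "\<And>n x. (D n has_vector_derivative D (Suc n) x) (at x)"
    and K: "compact K" "K \<subseteq> \<Omega>" "\<And>x. x \<notin> K \<Longrightarrow> \<psi> x = 0"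
    unfolding test_functions_def smooth_def by blast
  have C: "((\<lambda>x. cnj (D n x)) has_vector_derivative cnj (D (Suc n) x)) (at x)" for n x
    by (rule bounded_linear.has_vector_derivative[OF bounded_linear_cnj D(2)])
  hence "smooth (\<lambda>x. cnj (\<psi> x))"
    unfolding smooth_def using D(1) by (intro exI[of _ "\<lambda>n x. cnj (D n x)"]) auto
  thus "(\<lambda>x. cnj (\<psi> x)) \<in> test_functions \<Omega>"
    using K unfolding test_functions_def by (auto intro!: exI[of _ K])
  show "dx (\<lambda>x. cnj (\<psi> x)) = (\<lambda>x. cnj (dx \<psi> x))"
  proof
    fix x
    have "dx \<psi> x = D 1 x"
      using D(2)[of 0] by (intro vector_derivative_at) (simp add: D(1))
    moreover have "dx (\<lambda>x. cnj (\<psi> x)) x = cnj (D 1 x)"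
      using C[of 0] by (intro vector_derivative_at) (simp add: D(1))
    ultimately show "dx (\<lambda>x. cnj (\<psi> x)) x = cnj (dx \<psi> x)" by simp
  qed
qed

lemma test_function_continuous:
  assumes "\<psi> \<in> test_functions \<Omega>"
  shows "continuous_on S \<psi>"
proof -
  from assms have "smooth \<psi>" by (simp add: test_functions_def)
  then obtain D where D: "D 0 = \<psi>" "\<And>n x. (D n has_vector_derivative D (Suc n) x) (at x)"
    unfolding smooth_def by blast
  show ?thesis
    using D(2)[of 0] unfolding D(1)
    by (meson continuous_at_imp_continuous_on has_vector_derivative_continuous)
qed

lemma test_function_in_L2_I: "\<psi> \<in> test_functions I \<Longrightarrow> \<psi> \<in> L2 I"
  by (intro continuous_in_L2_I test_function_continuous)

lemma weak_derivD:
  "weak_deriv \<Omega> f g \<Longrightarrow> \<psi> \<in> test_functions \<Omega> \<Longrightarrow>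
     (LINT x|lebesgue_on \<Omega>. f x * dx \<psi> x) = - (LINT x|lebesgue_on \<Omega>. g x * \<psi> x)"
  by (simp add: weak_deriv_def)

lemma weak_deriv_of_C1:
  assumes d: "\<And>x. (p has_vector_derivative p' x) (at x)" and c: "continuous_on UNIV p'"
  shows "weak_deriv I p p'"
  unfolding weak_deriv_def
proof (intro conjI ballI)
  have cp: "continuous_on {-1..1} p"
    by (meson d continuous_at_imp_continuous_on has_vector_derivative_continuous)
  have cp': "continuous_on {-1..1} p'" using c continuous_on_subset by blast
  show "p \<in> L2 I" "p' \<in> L2 I" by (intro continuous_in_L2_I cp cp')+
  fix \<psi> assume t: "\<psi> \<in> test_functions I"
  then obtain D b where D: "D 0 = \<psi>" "\<And>n x. (D n has_vector_derivative D (Suc n) x) (at x)"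
    "\<And>x. dx \<psi> x = D 1 x" "0 < b" "b < 1" "\<And>n x. b \<le> \<bar>x\<bar> \<Longrightarrow> D n x = 0"
    by (rule test_functionE) blast
  have c\<psi>: "continuous_on {-1..1} \<psi>" "continuous_on {-1..1} (D 1)"
    using test_function_continuous[OF t] test_function_continuous[OF test_function_dx[OF t]]
    by (auto simp: D(3))
  have d\<psi>: "(\<psi> has_vector_derivative D 1 x) (at x)" for x using D(2)[of 0] by (simp add: D(1))
  have z: "\<psi> 1 = 0" "\<psi> (-1) = 0" using D(6)[of _ 0] \<open>b < 1\<close> by (auto simp: D(1))
  have "((\<lambda>x. p x * D 1 x + p' x * \<psi> x) has_integral p 1 * \<psi> 1 - p (-1) * \<psi> (-1)) {-1..1}"
    by (rule fundamental_theorem_of_calculus)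
       (simp, rule has_vector_derivative_at_within[OF has_vector_derivative_mult[OF d d\<psi>]])
  hence "integral {-1..1} (\<lambda>x. p x * D 1 x + p' x * \<psi> x) = 0"
    using z by (simp add: integral_unique)
  moreover have "integrable (lebesgue_on I) (\<lambda>x. p x * D 1 x)" "integrable (lebesgue_on I) (\<lambda>x. p' x * \<psi> x)"
    by (intro continuous_integrable_I continuous_intros cp cp' c\<psi>)+
  moreover have "continuous_on {-1..1} (\<lambda>x. p x * D 1 x + p' x * \<psi> x)"
    by (intro continuous_intros cp cp' c\<psi>)
  ultimately show "(LINT x|lebesgue_on I. p x * dx \<psi> x) = - (LINT x|lebesgue_on I. p' x * \<psi> x)"
    unfolding D(3) using continuous_integrable_I(2)[of "\<lambda>x. p x * D 1 x + p' x * \<psi> x"]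
    by (simp add: eq_neg_iff_add_eq_0)
qed

text \<open>Jacobi's factorisation: with a positive solution \<open>\<phi>\<close>, the quadratic form of the operator
  minus \<open>\<mu>\<close> is the integral of \<open>|\<psi>' - (\<phi>'/\<phi>) \<psi>|\<^sup>2\<close>.\<close>

lemma quadratic_form_nonneg:
  fixes \<phi> \<phi>' :: "real \<Rightarrow> real"
  assumes pos: "\<And>x. x \<in> I \<Longrightarrow> 0 < \<phi> x"
    and d: "\<And>x. x \<in> I \<Longrightarrow> (\<phi> has_real_derivative \<phi>' x) (at x)"
    and d': "\<And>x. x \<in> I \<Longrightarrow> (\<phi>' has_real_derivative ((\<alpha> * x)\<^sup>2 - \<mu>) * \<phi> x) (at x)"
    and t: "\<psi> \<in> test_functions I"
  shows "0 \<le> (LINT x|lebesgue_on I. (cmod (dx \<psi> x))\<^sup>2 + ((\<alpha> * x)\<^sup>2 - \<mu>) * (cmod (\<psi> x))\<^sup>2)"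
proof -
  from t obtain D b where D: "D 0 = \<psi>" "\<And>n x. (D n has_vector_derivative D (Suc n) x) (at x)"
    "\<And>x. dx \<psi> x = D 1 x" "0 < b" "b < 1" "\<And>n x. b \<le> \<bar>x\<bar> \<Longrightarrow> D n x = 0"
    by (rule test_functionE) blast
  have c\<psi>: "continuous_on S \<psi>" "continuous_on S (D 1)" for S
    using test_function_continuous[OF t] test_function_continuous[OF test_function_dx[OF t]]
    by (auto simp: D(3))
  have d\<psi>: "(\<psi> has_vector_derivative D 1 x) (at x)" for x using D(2)[of 0] by (simp add: D(1))
  define N where "N = (\<lambda>x. (cmod (D 1 x))\<^sup>2 + ((\<alpha> * x)\<^sup>2 - \<mu>) * (cmod (\<psi> x))\<^sup>2)"
  have cN: "continuous_on S N" for S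
    unfolding N_def by (intro continuous_intros c\<psi>)
  define r where "r = (\<lambda>x. Re (\<psi> x))"
  define i where "i = (\<lambda>x. Im (\<psi> x))"
  have dr: "(r has_real_derivative Re (D 1 x)) (at x)"
    and di: "(i has_real_derivative Im (D 1 x)) (at x)" for x
    unfolding r_def i_def has_real_derivative_iff_has_vector_derivative
    by (intro bounded_linear.has_vector_derivative[OF bounded_linear_Re d\<psi>]
              bounded_linear.has_vector_derivative[OF bounded_linear_Im d\<psi>])+
  \<comment> \<open>The logarithmic derivative satisfies the Riccati equation \<kappa>' = (\<alpha>
    x)^2 - \<mu> - \<kappa>^2, which makes the integrand minus (\<kappa> |\<psi>|^2)' a sum of
    squares.\<close>
  define \<kappa> where "\<kappa> = (\<lambda>x. \<phi>' x / \<phi> x)"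
  define Q where "Q = (\<lambda>x. \<kappa> x * ((r x)\<^sup>2 + (i x)\<^sup>2))"
  define Q' where "Q' = (\<lambda>x. ((\<alpha> * x)\<^sup>2 - \<mu> - (\<kappa> x)\<^sup>2) * ((r x)\<^sup>2 + (i x)\<^sup>2)
                         + \<kappa> x * (2 * r x * Re (D 1 x) + 2 * i x * Im (D 1 x)))"
  have dQ: "(Q has_real_derivative Q' x) (at x)" if x: "x \<in> I" for x
  proof -
    have "(\<kappa> has_real_derivative (\<alpha> * x)\<^sup>2 - \<mu> - (\<kappa> x)\<^sup>2) (at x)"
      unfolding \<kappa>_def
      by (rule derivative_eq_intros d[OF x] d'[OF x] refl | use pos[OF x] in simp; fail)+
         (use pos[OF x] in \<open>simp add: field_simps power2_eq_square\<close>)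
    note d\<kappa> = this
    show ?thesis
      unfolding Q_def Q'_def
      by (rule derivative_eq_intros d\<kappa> dr di refl)+ (simp add: algebra_simps)
  qed
  have le: "Q' x \<le> N x" for x
  proof -
    have "0 \<le> (Re (D 1 x) - \<kappa> x * r x)\<^sup>2 + (Im (D 1 x) - \<kappa> x * i x)\<^sup>2" by simp
    also have "\<dots> = N x - Q' x"
      unfolding N_def Q'_def cmod_power2 r_def i_def by (simp add: algebra_simps power2_eq_square)
    finally show ?thesis by simp
  qed
  have z: "r b = 0" "i b = 0" "r (-b) = 0" "i (-b) = 0"
    using D(4) D(6)[of _ 0] by (auto simp: r_def i_def D(1))
  have "(Q' has_integral Q b - Q (-b)) {-b..b}"
    by (rule fundamental_theorem_of_calculus)
       (use D(4,5) in \<open>auto intro!: has_field_derivative_at_within dQ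
          simp flip: has_real_derivative_iff_has_vector_derivative\<close>)
  hence "(Q' has_integral 0) {-b..b}" by (simp add: Q_def z)
  moreover have Nb: "(N has_integral integral {-b..b} N) {-b..b}"
    by (intro integrable_integral integrable_continuous_real cN)
  ultimately have "0 \<le> integral {-b..b} N"
    using le by (blast intro: has_integral_le)
  also have "\<dots> = integral {-1..1} N"
  proof -
    have "(N has_integral integral {-b..b} N) {-1..1}"
    proof (rule has_integral_on_superset[OF Nb])
      show "N x = 0" if "x \<notin> {-b..b}" for x
      proof -
        have "b \<le> \<bar>x\<bar>" using that by auto
        from D(6)[OF this, of 0] D(6)[OF this, of 1] show ?thesis by (simp add: N_def D(1))
      qed
    qed (use D(5) in auto)
    thus ?thesis by (simp add: integral_unique)
  qed
  also have "\<dots> = (LINT x|lebesgue_on I. N x)"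
    using continuous_integrable_I(2)[OF cN] by simp
  finally show ?thesis by (simp add: N_def D(3))
qed

text \<open>Testing the equation with approximations of u gives the energy identity: the integral of
  |g|^2 equals that of (l - (\<alpha> x)^2) |u|^2. The form inequality for test functions passes to
  the limit u, and together they say 0 \<le> (l - \<mu>) times the squared norm of u.\<close>

lemma eigenvalue_ge:
  fixes \<phi> \<phi>' :: "real \<Rightarrow> real"
  assumes pos: "\<And>x. x \<in> I \<Longrightarrow> 0 < \<phi> x"
    and d: "\<And>x. x \<in> I \<Longrightarrow> (\<phi> has_real_derivative \<phi>' x) (at x)"
    and d': "\<And>x. x \<in> I \<Longrightarrow> (\<phi>' has_real_derivative ((\<alpha> * x)\<^sup>2 - \<mu>) * \<phi> x) (at x)"
    and ev: "dirichlet_eigenvalue \<alpha> (of_real l)"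
  shows "\<mu> \<le> l"
proof -
  let ?L = "lebesgue_on I"
  obtain u h where u: "u \<in> H10 I" and h2: "weak_deriv2 I u h"
    and eq: "AE x in ?L. of_real l * u x = - h x + of_real ((\<alpha> * x)\<^sup>2) * u x"
    and nz: "\<not> (AE x in ?L. u x = 0)"
    using ev unfolding dirichlet_eigenvalue_def dirichlet_oscillator_def by blast
  obtain g \<psi> where g: "weak_deriv I u g" and \<psi>: "\<And>n. \<psi> n \<in> test_functions I"
    and lim: "(\<lambda>n. (LINT x|?L. (cmod (u x - \<psi> n x))\<^sup>2) + (LINT x|?L. (cmod (g x - dx (\<psi> n) x))\<^sup>2))
                \<longlonglongrightarrow> 0"
    using u unfolding H10_def by blast
  obtain k where k: "weak_deriv I u k" "weak_deriv I k h"
    using h2 unfolding weak_deriv2_def by blast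
  have L2: "u \<in> L2 I" "g \<in> L2 I" "k \<in> L2 I" "h \<in> L2 I"
    using g k by (auto simp: weak_deriv_def)
  note t\<psi> = test_function_in_L2_I[OF \<psi>] test_function_in_L2_I[OF test_function_dx[OF \<psi>]]
  have lu: "(\<lambda>n. LINT x|?L. (cmod (u x - \<psi> n x))\<^sup>2) \<longlonglongrightarrow> 0"
    by (rule Lim_null_comparison[OF _ lim]) (auto intro!: always_eventually)
  have lg: "(\<lambda>n. LINT x|?L. (cmod (g x - dx (\<psi> n) x))\<^sup>2) \<longlonglongrightarrow> 0"
    by (rule Lim_null_comparison[OF _ lim]) (auto intro!: always_eventually)
  have cn: "(cmod (cnj a - cnj b))\<^sup>2 = (cmod (a - b))\<^sup>2" for a b
    by (metis complex_cnj_diff complex_mod_cnj)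
  \<comment> \<open>The derivative \<open>g\<close> comes from \<open>H10\<close> and
    \<open>k\<close> from \<open>weak_deriv2\<close>. They are compared only through their pairings
    with test functions, here the derivative of a conjugated one.\<close>
  have "(LINT x|?L. cnj (dx (\<psi> n) x) * g x) = - (LINT x|?L. cnj (\<psi> n x) * h x)" for n
  proof -
    note C = test_function_cnj[OF \<psi>[of n]] test_function_cnj[OF test_function_dx[OF \<psi>[of n]]]
    have "(LINT x|?L. g x * cnj (dx (\<psi> n) x)) = (LINT x|?L. k x * cnj (dx (\<psi> n) x))"
      using weak_derivD[OF g C(3)] weak_derivD[OF k(1) C(3)] by simp
    also have "\<dots> = - (LINT x|?L. h x * cnj (\<psi> n x))"
      using weak_derivD[OF k(2) C(1)] by (simp add: fun_cong[OF C(2)])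
    finally show ?thesis by (simp add: mult.commute)
  qed
  moreover have "(\<lambda>n. LINT x|?L. cnj (dx (\<psi> n) x) * g x) \<longlonglongrightarrow> (LINT x|?L. cnj (g x) * g x)"
    using lg by (intro L2_tendsto_integral_mult L2_cnj L2 t\<psi>) (simp add: cn)
  moreover have "(\<lambda>n. - (LINT x|?L. cnj (\<psi> n x) * h x)) \<longlonglongrightarrow> - (LINT x|?L. cnj (u x) * h x)"
    using lu by (intro tendsto_minus L2_tendsto_integral_mult L2_cnj L2 t\<psi>) (simp add: cn)
  ultimately have "(LINT x|?L. cnj (g x) * g x) = - (LINT x|?L. cnj (u x) * h x)"
    using LIMSEQ_unique by simp
  also have "\<dots> = (LINT x|?L. - (cnj (u x) * h x))" by simp
  also have "\<dots> = (LINT x|?L. of_real ((l - (\<alpha> * x)\<^sup>2) * (cmod (u x))\<^sup>2))"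
  proof (rule integral_cong_AE)
    show "(\<lambda>x. - (cnj (u x) * h x)) \<in> borel_measurable ?L"
      using L2_mult_integrable[OF L2_cnj[OF L2(1)] L2(4)] by (intro borel_measurable_uminus) auto
    have [measurable]: "u \<in> borel_measurable ?L" "(\<lambda>x. x) \<in> borel_measurable ?L"
      using L2 L2_measurable id_borel_measurable_lebesgue_on by (auto simp: id_def)
    show "(\<lambda>x. complex_of_real ((l - (\<alpha> * x)\<^sup>2) * (cmod (u x))\<^sup>2)) \<in> borel_measurable ?L"
      by measurable
    from eq show "AE x in ?L. - (cnj (u x) * h x) = of_real ((l - (\<alpha> * x)\<^sup>2) * (cmod (u x))\<^sup>2)"
    proof eventually_elim
      case (elim x)
      have h: "h x = of_real ((\<alpha> * x)\<^sup>2) * u x - of_real l * u x" using elim by simp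
      have "- (cnj (u x) * h x) = of_real (l - (\<alpha> * x)\<^sup>2) * (u x * cnj (u x))"
        unfolding h by (simp add: algebra_simps)
      also have "u x * cnj (u x) = of_real ((cmod (u x))\<^sup>2)"
        by (rule complex_norm_square[symmetric])
      finally show ?case by (simp only: of_real_mult)
    qed
  qed
  also have "\<dots> = of_real (LINT x|?L. (l - (\<alpha> * x)\<^sup>2) * (cmod (u x))\<^sup>2)"
    by (rule integral_complex_of_real)
  also have "(LINT x|?L. cnj (g x) * g x) = (LINT x|?L. of_real ((cmod (g x))\<^sup>2))"
    by (rule Bochner_Integration.integral_cong) (auto simp: complex_norm_square mult.commute simp del: of_real_power)
  also have "\<dots> = of_real (LINT x|?L. (cmod (g x))\<^sup>2)"
    by (rule integral_complex_of_real)
  finally have energy: "(LINT x|?L. (cmod (g x))\<^sup>2) = (LINT x|?L. (l - (\<alpha> * x)\<^sup>2) * (cmod (u x))\<^sup>2)"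
    by (simp only: of_real_eq_iff)
  have cb: "\<bar>(\<alpha> * x)\<^sup>2 - c\<bar> \<le> \<alpha>\<^sup>2 + \<bar>c\<bar>" if "x \<in> I" for x c
  proof -
    have "\<bar>x\<bar> \<le> 1" using that by auto
    hence "x\<^sup>2 \<le> 1" by (simp add: abs_square_le_1)
    hence "\<alpha>\<^sup>2 * x\<^sup>2 \<le> \<alpha>\<^sup>2 * 1" by (intro mult_left_mono) auto
    moreover have "0 \<le> \<alpha>\<^sup>2 * x\<^sup>2" by simp
    ultimately show ?thesis unfolding power_mult_distrib by linarith
  qed
  have cm: "(\<lambda>x. (\<alpha> * x)\<^sup>2 - c) \<in> borel_measurable ?L" for c
    by (rule borel_measurable_integrable, rule continuous_integrable_I) (intro continuous_intros)
  have wi: "integrable ?L (\<lambda>x. ((\<alpha> * x)\<^sup>2 - c) * (cmod (f x))\<^sup>2)" if f: "f \<in> L2 I" for f c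
  proof (rule Bochner_Integration.integrable_bound)
    show "integrable ?L (\<lambda>x. (\<alpha>\<^sup>2 + \<bar>c\<bar>) * (cmod (f x))\<^sup>2)"
      using L2_integrable_square[OF f] by simp
    show "(\<lambda>x. ((\<alpha> * x)\<^sup>2 - c) * (cmod (f x))\<^sup>2) \<in> borel_measurable ?L"
      using cm L2_integrable_square[OF f] by (intro borel_measurable_times) auto
    show "AE x in ?L. norm (((\<alpha> * x)\<^sup>2 - c) * (cmod (f x))\<^sup>2) \<le> norm ((\<alpha>\<^sup>2 + \<bar>c\<bar>) * (cmod (f x))\<^sup>2)"
      using cb by (intro AE_I2) (auto simp: abs_mult space_restrict_space intro!: mult_right_mono)
  qed
  have "(\<lambda>n. (LINT x|?L. 1 * (cmod (dx (\<psi> n) x))\<^sup>2) + (LINT x|?L. ((\<alpha> * x)\<^sup>2 - \<mu>) * (cmod (\<psi> n x))\<^sup>2))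
      \<longlonglongrightarrow> (LINT x|?L. 1 * (cmod (g x))\<^sup>2) + (LINT x|?L. ((\<alpha> * x)\<^sup>2 - \<mu>) * (cmod (u x))\<^sup>2)"
    by (intro tendsto_add L2_tendsto_weighted_square[where C = 1]
          L2_tendsto_weighted_square[where C = "\<alpha>\<^sup>2 + \<bar>\<mu>\<bar>"] L2 t\<psi> cm cb lu lg) auto
  moreover have "0 \<le> (LINT x|?L. 1 * (cmod (dx (\<psi> n) x))\<^sup>2)
                    + (LINT x|?L. ((\<alpha> * x)\<^sup>2 - \<mu>) * (cmod (\<psi> n x))\<^sup>2)" for n
    using quadratic_form_nonneg[OF pos d d' \<psi>[of n]] wi[OF t\<psi>(1)] L2_integrable_square[OF t\<psi>(2)] by simp
  ultimately have "0 \<le> (LINT x|?L. (cmod (g x))\<^sup>2) + (LINT x|?L. ((\<alpha> * x)\<^sup>2 - \<mu>) * (cmod (u x))\<^sup>2)"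
    by (intro LIMSEQ_le_const) auto
  also have "(LINT x|?L. (cmod (g x))\<^sup>2) = - (LINT x|?L. ((\<alpha> * x)\<^sup>2 - l) * (cmod (u x))\<^sup>2)"
    unfolding energy by (simp flip: integral_minus add: minus_mult_left)
  also have "\<dots> + (LINT x|?L. ((\<alpha> * x)\<^sup>2 - \<mu>) * (cmod (u x))\<^sup>2)
      = (LINT x|?L. ((\<alpha> * x)\<^sup>2 - \<mu>) * (cmod (u x))\<^sup>2 - ((\<alpha> * x)\<^sup>2 - l) * (cmod (u x))\<^sup>2)"
    using wi[OF L2(1)] by simp
  also have "\<dots> = (LINT x|?L. (l - \<mu>) * (cmod (u x))\<^sup>2)"
    by (rule Bochner_Integration.integral_cong) (auto simp: algebra_simps)
  also have "\<dots> = (l - \<mu>) * (LINT x|?L. (cmod (u x))\<^sup>2)" by simp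
  finally have "0 \<le> (l - \<mu>) * (LINT x|?L. (cmod (u x))\<^sup>2)" .
  moreover have "0 < (LINT x|?L. (cmod (u x))\<^sup>2)"
  proof -
    have "(LINT x|?L. (cmod (u x))\<^sup>2) \<noteq> 0"
      using nz integral_nonneg_eq_0_iff_AE[OF L2_integrable_square[OF L2(1)]] by simp
    thus ?thesis by (simp add: order.strict_iff_order)
  qed
  ultimately show ?thesis by (simp add: zero_le_mult_iff)
qed

section \<open>Cut-offs of entire functions\<close>

text \<open>The usual flat function e^(-1/t), together with its quotients by powers of t: this
  family is closed under differentiation up to linear combinations.\<close>

definition bump :: "nat \<Rightarrow> real \<Rightarrow> real" where
  "bump k t = (if t > 0 then exp (- 1 / t) / t ^ k else 0)"

lemma bump_nonneg: "0 \<le> bump k t" by (simp add: bump_def)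

lemma bump_Suc: "t * bump (Suc k) t = bump k t"
  by (simp add: bump_def)

text \<open>With y = 1/t this is y^k e^(-y) \<le> k^k, from (y/k)^k \<le> (1 + y/k)^k \<le> e^y. For
  k = 0 the bound is 0^0 = 1.\<close>

lemma bump_le: "bump k t \<le> real k ^ k"
proof (cases "t > 0")
  case True
  have "(1 / t) ^ k \<le> real k ^ k * exp (1 / t)"
  proof (cases "k = 0")
    case False
    have "(1 / t / real k) ^ k \<le> (1 + 1 / t / real k) ^ k"
      using True by (intro power_mono) auto
    also have "\<dots> \<le> exp (1 / t)"
    proof (rule exp_ge_one_plus_x_over_n_power_n)
      have "0 \<le> 1 / t" using True by simp
      thus "- real k \<le> 1 / t" by linarith
    qed (use False in simp)
    finally have "real k ^ k * (1 / t / real k) ^ k \<le> real k ^ k * exp (1 / t)"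
      by (rule mult_left_mono) simp
    thus ?thesis using False by (simp add: power_divide power_mult_distrib)
  qed (use True in simp)
  thus ?thesis using True by (simp add: bump_def power_divide exp_minus field_simps)
qed (simp add: bump_def)

text \<open>At t = 0 the difference quotient equals h \<open>bump (k + 2) h\<close>, and the second
  factor is bounded.\<close>

lemma bump_DERIV:
  "(bump k has_real_derivative bump (k + 2) t - real k * bump (k + 1) t) (at t)"
proof (rule linorder_cases[of t 0])
  assume t: "t < 0"
  have "((\<lambda>_. 0) has_real_derivative 0) (at t)" by simp
  hence "(bump k has_real_derivative 0) (at t)"
    by (rule has_field_derivative_transform_within_open[of _ _ _ "{..<0}"])
       (use t in \<open>auto simp: bump_def\<close>)
  thus ?thesis using t by (simp add: bump_def)
next
  assume t: "t > 0"
  have "((\<lambda>t. exp (- 1 / t) / t ^ k) has_real_derivative bump (k + 2) t - real k * bump (k + 1) t) (at t)"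
    by (rule derivative_eq_intros refl | use t in simp; fail)+
       (use t in \<open>cases k; simp add: bump_def field_simps power2_eq_square power_add\<close>)
  thus ?thesis
    by (rule has_field_derivative_transform_within_open[of _ _ _ "{0<..}"])
       (use t in \<open>auto simp: bump_def\<close>)
next
  assume t: "t = 0"
  have "((\<lambda>h. (bump k (0 + h) - bump k 0) / h) \<longlongrightarrow> 0) (at 0)"
  proof (rule Lim_null_comparison)
    have "\<bar>(bump k (0 + h) - bump k 0) / h\<bar> \<le> \<bar>h\<bar> * real (k + 2) ^ (k + 2)" if "h \<noteq> 0" for h
    proof -
      have "(bump k (0 + h) - bump k 0) / h = h * bump (k + 2) h"
        using bump_Suc[of h k] bump_Suc[of h "Suc k"] that by (simp add: bump_def[of k 0] field_simps)
      thus ?thesis using bump_le[of "k + 2" h] bump_nonneg[of "k + 2" h]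
        by (simp add: abs_mult mult_left_mono del: of_nat_add)
    qed
    thus "\<forall>\<^sub>F h in at 0. norm ((bump k (0 + h) - bump k 0) / h) \<le> \<bar>h\<bar> * real (k + 2) ^ (k + 2)"
      by (auto simp: eventually_at_filter)
    show "((\<lambda>h. \<bar>h\<bar> * real (k + 2) ^ (k + 2)) \<longlongrightarrow> 0) (at 0)"
      by (auto intro!: tendsto_eq_intros)
  qed
  hence "(bump k has_real_derivative 0) (at 0)" by (simp add: DERIV_def)
  thus ?thesis using t by (simp add: bump_def)
qed

lemma bump_at_top:
  "(bump 0 \<longlongrightarrow> 1) at_top" "(bump (Suc k) \<longlongrightarrow> 0) at_top"
proof -
  have i: "((\<lambda>t::real. 1 / t) \<longlongrightarrow> 0) at_top"
    by (intro tendsto_divide_0[OF tendsto_const] filterlim_at_top_imp_at_infinity filterlim_ident)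
  have "((\<lambda>t::real. exp (- (1 / t))) \<longlongrightarrow> exp (- 0)) at_top"
    by (intro tendsto_intros i)
  moreover have "\<forall>\<^sub>F t in at_top. exp (- (1 / t)) = bump 0 t"
    using eventually_gt_at_top[of 0] by eventually_elim (simp add: bump_def)
  ultimately show "(bump 0 \<longlongrightarrow> 1) at_top" by (simp add: tendsto_cong)
  show "(bump (Suc k) \<longlongrightarrow> 0) at_top"
  proof (rule Lim_null_comparison[OF _ i])
    show "\<forall>\<^sub>F t in at_top. norm (bump (Suc k) t) \<le> 1 / t"
      using eventually_ge_at_top[of 1]
    proof eventually_elim
      case (elim t)
      have "exp (- 1 / t) / t ^ Suc k \<le> 1 / t ^ Suc k"
        using elim by (intro divide_right_mono) auto
      also have "\<dots> \<le> 1 / t"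
        using elim power_increasing[of 1 "Suc k" t] by (intro divide_left_mono) auto
      finally show ?case using elim by (simp add: bump_def)
    qed
  qed
qed

section \<open>Approximation by test functions\<close>

text \<open>The factor is nonzero only where 1 - x^2 > 1/N, so the summand -1 keeps the support away
  from the endpoints, while its argument tends to infinity at each interior point. The argument is
  polynomial in x, so differentiation leaves the coefficients entire.\<close>

definition cutoff :: "nat \<Rightarrow> (complex \<Rightarrow> complex) \<Rightarrow> real \<Rightarrow> complex" where
  "cutoff N p x = p (of_real x) * of_real (bump 0 (real N * (1 - x\<^sup>2) - 1))"

text \<open>All derivatives of a cut-off entire function have the form \<open>p(x) bump 2n (N (1 - x\<^sup>2) - 1)\<close>
  with \<open>p\<close> entire.\<close>

primrec cutoff_factor :: "nat \<Rightarrow> (complex \<Rightarrow> complex) \<Rightarrow> nat \<Rightarrow> complex \<Rightarrow> complex" where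
  "cutoff_factor N p 0 = p"
| "cutoff_factor N p (Suc n) = (\<lambda>w.
     deriv (cutoff_factor N p n) w * (of_nat N * (1 - w\<^sup>2) - 1)\<^sup>2
     + cutoff_factor N p n w * (- 2 * of_nat N * w) * (1 - 2 * of_nat n * (of_nat N * (1 - w\<^sup>2) - 1)))"

lemma cutoff_factor_holomorphic:
  "p holomorphic_on UNIV \<Longrightarrow> cutoff_factor N p n holomorphic_on UNIV"
  by (induction n) (auto intro!: holomorphic_intros holomorphic_deriv)

text \<open>With T = N (1 - x^2) - 1, the bumps of index 2n and 2n + 1 are T^2 and T times the bump
  of index 2n + 2, so the latter is a common factor in the product rule.\<close>

lemma cutoff_factor_has_vector_derivative:
  fixes N :: nat
  assumes p: "p holomorphic_on UNIV"
  defines "T \<equiv> \<lambda>x. real N * (1 - x\<^sup>2) - 1"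
  shows "((\<lambda>x. cutoff_factor N p n (of_real x) * of_real (bump (2 * n) (T x))) has_vector_derivative
            cutoff_factor N p (Suc n) (of_real x) * of_real (bump (2 * Suc n) (T x))) (at x)"
proof -
  let ?P = "cutoff_factor N p n"
  have dP: "((\<lambda>x. ?P (of_real x)) has_vector_derivative deriv ?P (of_real x)) (at x)"
    using cutoff_factor_holomorphic[OF p, of N n]
    by (intro has_vector_derivative_real_field holomorphic_derivI) auto
  have dT: "(T has_real_derivative - 2 * real N * x) (at x)"
    unfolding T_def by (auto intro!: derivative_eq_intros)
  define B where "B = bump (2 * Suc n) (T x)"
  have b1: "bump (2 * n + 1) (T x) = T x * B" and b0: "bump (2 * n) (T x) = (T x)\<^sup>2 * B"
    using bump_Suc[of "T x" "2 * n"] bump_Suc[of "T x" "Suc (2 * n)"]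
    by (simp_all add: B_def power2_eq_square mult.assoc)
  have "((\<lambda>x. bump (2 * n) (T x)) has_real_derivative
          (bump (2 * n + 2) (T x) - real (2 * n) * bump (2 * n + 1) (T x)) * (- 2 * real N * x)) (at x)"
    by (rule DERIV_chain2[OF bump_DERIV dT])
  hence "((\<lambda>x. bump (2 * n) (T x)) has_real_derivative
           (1 - 2 * real n * T x) * (- 2 * real N * x) * B) (at x)"
    by (rule DERIV_cong) (unfold b1, simp add: B_def algebra_simps)
  from has_vector_derivative_of_real[OF this]
  have "((\<lambda>x. ?P (of_real x) * of_real (bump (2 * n) (T x))) has_vector_derivative
          ?P (of_real x) * of_real ((1 - 2 * real n * T x) * (- 2 * real N * x) * B)
          + deriv ?P (of_real x) * of_real (bump (2 * n) (T x))) (at x)"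
    by (rule has_vector_derivative_mult[OF dP])
  thus ?thesis
    by (rule has_vector_derivative_eq_rhs)
       (unfold b0 B_def[symmetric], simp add: T_def algebra_simps)
qed

lemma cutoff_test_function:
  assumes p: "p holomorphic_on UNIV"
  shows "cutoff N p \<in> test_functions I"
    and "dx (cutoff N p) x = deriv p (of_real x) * of_real (bump 0 (real N * (1 - x\<^sup>2) - 1))
           - p (of_real x) * of_real (2 * real N * x * bump 2 (real N * (1 - x\<^sup>2) - 1))"
proof -
  define T where "T = (\<lambda>x. real N * (1 - x\<^sup>2) - 1)"
  define D where "D = (\<lambda>n x. cutoff_factor N p n (of_real x) * of_real (bump (2 * n) (T x)))"
  have dD: "(D n has_vector_derivative D (Suc n) x) (at x)" for n x
    unfolding D_def T_def by (rule cutoff_factor_has_vector_derivative[OF p])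
  have D0: "D 0 = cutoff N p" by (simp add: D_def cutoff_def[abs_def] T_def)
  define K where "K = {-1..1} \<inter> {x. 0 \<le> T x}"
  have "compact K"
    unfolding K_def T_def
    by (intro compact_Int_closed compact_Icc closed_Collect_le continuous_intros)
  moreover have "K \<subseteq> I"
  proof
    fix x assume "x \<in> K"
    hence "-1 \<le> x" "x \<le> 1" "0 \<le> T x" by (auto simp: K_def)
    moreover have "x \<noteq> 1" "x \<noteq> -1" using \<open>0 \<le> T x\<close> by (auto simp: T_def)
    ultimately show "x \<in> I" by simp
  qed
  moreover have "cutoff N p x = 0" if "x \<notin> K" for x
  proof -
    have "T x < 0"
    proof (cases "x \<in> {-1..1}")
      case False
      hence "1 < \<bar>x\<bar>" by auto
      hence "1 \<le> x\<^sup>2" by (simp add: abs_square_le_1 less_imp_le flip: abs_le_square_iff[of 1 x, simplified])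
      hence "real N * (1 - x\<^sup>2) \<le> 0" by (simp add: mult_nonneg_nonpos)
      thus ?thesis by (simp add: T_def)
    qed (use that in \<open>auto simp: K_def\<close>)
    thus ?thesis by (simp add: cutoff_def bump_def T_def)
  qed
  moreover have "smooth (cutoff N p)"
    unfolding smooth_def using D0 dD by blast
  ultimately show "cutoff N p \<in> test_functions I"
    unfolding test_functions_def by blast
  have "dx (cutoff N p) x = D 1 x"
    using dD[of 0] by (intro vector_derivative_at) (simp add: D0)
  also have "\<dots> = (deriv p (of_real x) * of_real ((T x)\<^sup>2) - p (of_real x) * of_real (2 * real N * x))
      * of_real (bump 2 (T x))"
    by (simp add: D_def T_def algebra_simps numeral_2_eq_2[symmetric])
  also have "\<dots> = deriv p (of_real x) * of_real (T x * (T x * bump 2 (T x)))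
      - p (of_real x) * of_real (2 * real N * x * bump 2 (T x))"
    by (simp add: algebra_simps power2_eq_square)
  also have "T x * (T x * bump 2 (T x)) = bump 0 (T x)"
    using bump_Suc[of "T x" 0] bump_Suc[of "T x" 1] by (simp add: numeral_2_eq_2)
  finally show "dx (cutoff N p) x = deriv p (of_real x) * of_real (bump 0 (real N * (1 - x\<^sup>2) - 1))
           - p (of_real x) * of_real (2 * real N * x * bump 2 (real N * (1 - x\<^sup>2) - 1))"
    by (simp add: T_def)
qed

text \<open>Both values come from a bound on p' over the closed unit disc and the mean value
  inequality from the nearer endpoint. The form 1 - x^2 is chosen to match the argument of the
  cut-off.\<close>

lemma entire_vanishing_bound:
  assumes p: "p holomorphic_on UNIV" and p1: "p 1 = 0" "p (-1) = 0"
  obtains C where "\<And>x::real. \<bar>x\<bar> \<le> 1 \<Longrightarrow> cmod (p (of_real x)) \<le> C * (1 - x\<^sup>2)"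
    and "\<And>x::real. \<bar>x\<bar> \<le> 1 \<Longrightarrow> cmod (deriv p (of_real x)) \<le> C"
proof -
  have dp: "((\<lambda>x. p (of_real x)) has_vector_derivative deriv p (of_real x)) (at x)" for x
    using p by (intro has_vector_derivative_real_field holomorphic_derivI) auto
  have "continuous_on UNIV (deriv p)"
    using p by (intro holomorphic_on_imp_continuous_on holomorphic_deriv) auto
  hence "continuous_on (cball 0 1) (deriv p)" using continuous_on_subset by blast
  hence "bounded (deriv p ` cball 0 1)"
    by (intro compact_imp_bounded compact_continuous_image) auto
  then obtain C where C: "\<And>w. w \<in> cball 0 1 \<Longrightarrow> cmod (deriv p w) \<le> C"
    unfolding bounded_iff by blast
  have C': "cmod (deriv p (of_real x)) \<le> C" if "\<bar>x\<bar> \<le> 1" for x :: real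
    using C[of "of_real x"] that by simp
  have C0: "0 \<le> C" using order_trans[OF norm_ge_zero C'[of 0]] by simp
  have "cmod (p (of_real x)) \<le> C * (1 - x\<^sup>2)" if "\<bar>x\<bar> \<le> 1" for x :: real
  proof -
    have "cmod (p (of_real x)) \<le> C * (1 - \<bar>x\<bar>)"
    proof (cases "x \<ge> 0")
      case True
      have "cmod (p (of_real 1) - p (of_real x)) \<le> C * (1 - x)"
        by (rule norm_diff_le_of_vector_derivative_le[OF dp]) (use C' that True in auto)
      thus ?thesis using True p1 by simp
    next
      case False
      have "cmod (p (of_real x) - p (of_real (-1))) \<le> C * (x - (-1))"
        by (rule norm_diff_le_of_vector_derivative_le[OF dp]) (use C' that False in auto)
      thus ?thesis using False p1 by (simp add: add.commute)
    qed
    also have "\<dots> \<le> C * (1 - x\<^sup>2)"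
    proof (rule mult_left_mono[OF _ C0])
      have "\<bar>x\<bar> * \<bar>x\<bar> \<le> \<bar>x\<bar> * 1" using that by (intro mult_left_mono) auto
      thus "1 - \<bar>x\<bar> \<le> 1 - x\<^sup>2" by (simp add: power2_eq_square)
    qed
    finally show ?thesis .
  qed
  with C' show ?thesis using that by blast
qed

text \<open>Dominated convergence for the cut-offs. The critical term is p times the derivative of
  the cut-off factor, which grows like N. It is tamed by |p| \<le> C (1 - x^2), because N (1 - x^2)
  = T + 1 and (T + 1) \<open>bump 2 T\<close> = \<open>bump 1 T\<close> + \<open>bump 2 T\<close>,
  which is bounded and tends to 0.\<close>

lemma entire_vanishing_in_H10:
  assumes p: "p holomorphic_on UNIV" and p1: "p 1 = 0" "p (-1) = 0"
  shows "(\<lambda>x. p (of_real x)) \<in> H10 I"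
proof -
  let ?L = "lebesgue_on I"
  obtain C where C: "\<And>x::real. \<bar>x\<bar> \<le> 1 \<Longrightarrow> cmod (p (of_real x)) \<le> C * (1 - x\<^sup>2)"
    "\<And>x::real. \<bar>x\<bar> \<le> 1 \<Longrightarrow> cmod (deriv p (of_real x)) \<le> C"
    by (rule entire_vanishing_bound[OF assms]) blast
  have C0: "0 \<le> C" using order_trans[OF norm_ge_zero C(2)[of 0]] by simp
  have cp: "continuous_on S (\<lambda>x. p (of_real x))" and cp': "continuous_on S (\<lambda>x. deriv p (of_real x))" for S
    by (rule continuous_on_compose2[OF holomorphic_on_imp_continuous_on[OF p] _ subset_UNIV]
             continuous_on_compose2[OF holomorphic_on_imp_continuous_on[OF holomorphic_deriv[OF p open_UNIV]] _ subset_UNIV],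
        intro continuous_intros)+
  have w: "weak_deriv I (\<lambda>x. p (of_real x)) (\<lambda>x. deriv p (of_real x))"
    using p cp' by (intro weak_deriv_of_C1 has_vector_derivative_real_field holomorphic_derivI) auto
  define T where "T = (\<lambda>n x. real (Suc n) * (1 - x\<^sup>2) - 1)"
  define \<psi> where "\<psi> = (\<lambda>n. cutoff (Suc n) p)"
  have t: "\<psi> n \<in> test_functions I" for n unfolding \<psi>_def by (rule cutoff_test_function[OF p])
  have \<psi>: "\<psi> n x = p (of_real x) * of_real (bump 0 (T n x))"
    and d\<psi>: "dx (\<psi> n) x = deriv p (of_real x) * of_real (bump 0 (T n x))
           - p (of_real x) * of_real (2 * real (Suc n) * x * bump 2 (T n x))" for n x
    unfolding \<psi>_def T_def cutoff_test_function(2)[OF p] by (simp_all only: cutoff_def)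
  have Ttop: "filterlim (\<lambda>n. T n x) at_top sequentially" if "x \<in> I" for x
  proof -
    have "\<bar>x\<bar> < 1" using that by auto
    hence "x\<^sup>2 < 1" by (simp add: abs_square_less_1)
    hence "filterlim (\<lambda>n. (1 - x\<^sup>2) * real (Suc n)) at_top sequentially"
      by (intro filterlim_tendsto_pos_mult_at_top[OF tendsto_const]
           filterlim_compose[OF filterlim_real_sequentially filterlim_Suc]) auto
    hence "filterlim (\<lambda>n. -1 + (1 - x\<^sup>2) * real (Suc n)) at_top sequentially"
      by (rule filterlim_tendsto_add_at_top[OF tendsto_const])
    thus ?thesis by (simp add: T_def mult.commute)
  qed
  have lb: "(\<lambda>n. bump 0 (T n x)) \<longlonglongrightarrow> 1" "(\<lambda>n. bump (Suc k) (T n x)) \<longlonglongrightarrow> 0" if "x \<in> I" for x k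
    using filterlim_compose[OF bump_at_top(1) Ttop[OF that]]
          filterlim_compose[OF bump_at_top(2) Ttop[OF that]] by auto
  have b01: "0 \<le> bump 0 s" "bump 0 s \<le> 1" for s
    using bump_nonneg[of 0 s] bump_le[of 0 s] by auto
  have dom: "(\<lambda>n. LINT x|?L. (cmod (f x - F n x))\<^sup>2) \<longlonglongrightarrow> 0"
    if "f \<in> L2 I" "\<And>n. F n \<in> L2 I" "\<And>x. x \<in> I \<Longrightarrow> (\<lambda>n. f x - F n x) \<longlonglongrightarrow> 0"
      "\<And>n x. x \<in> I \<Longrightarrow> cmod (f x - F n x) \<le> B" for f F B
  proof -
    have "(\<lambda>n. LINT x|?L. (cmod (f x - F n x))\<^sup>2) \<longlonglongrightarrow> (LINT x|?L. 0)"
    proof (rule integral_dominated_convergence)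
      show "integrable ?L (\<lambda>_. B\<^sup>2)" by (rule continuous_integrable_I) simp
      show "AE x in ?L. (\<lambda>n. (cmod (f x - F n x))\<^sup>2) \<longlonglongrightarrow> 0"
        using that(3) by (intro AE_I2) (auto simp: tendsto_norm_zero_iff)
      show "AE x in ?L. norm ((cmod (f x - F n x))\<^sup>2) \<le> B\<^sup>2" for n
        using that(4) by (intro AE_I2) (auto intro!: power_mono)
      show "(\<lambda>x. (cmod (f x - F n x))\<^sup>2) \<in> borel_measurable ?L" for n
        using L2_integrable_square[OF L2_diff[OF that(1,2)]] by (rule borel_measurable_integrable)
    qed simp
    thus ?thesis by simp
  qed
  have l1: "(\<lambda>n. LINT x|?L. (cmod (p (of_real x) - \<psi> n x))\<^sup>2) \<longlonglongrightarrow> 0"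
  proof (rule dom)
    fix x assume x: "x \<in> I"
    have "(\<lambda>n. p (of_real x) - \<psi> n x) \<longlonglongrightarrow> p (of_real x) - p (of_real x) * of_real 1"
      unfolding \<psi> by (intro tendsto_intros lb x)
    thus "(\<lambda>n. p (of_real x) - \<psi> n x) \<longlonglongrightarrow> 0" by simp
    show "cmod (p (of_real x) - \<psi> n x) \<le> C" for n
    proof -
      have "p (of_real x) - \<psi> n x = p (of_real x) * of_real (1 - bump 0 (T n x))"
        unfolding \<psi> by (simp add: algebra_simps)
      hence "cmod (p (of_real x) - \<psi> n x) = cmod (p (of_real x)) * (1 - bump 0 (T n x))"
        using b01[of "T n x"] by (simp only: norm_mult norm_of_real)
      also have "\<dots> \<le> C * (1 - x\<^sup>2) * 1"
        using C(1)[of x] b01[of "T n x"] x C0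
        by (intro mult_mono) (auto simp: abs_square_le_1 less_imp_le)
      also have "\<dots> \<le> C" using C0 by (simp add: algebra_simps)
      finally show ?thesis .
    qed
  qed (use w t test_function_in_L2_I in \<open>auto simp: weak_deriv_def\<close>)
  have l2: "(\<lambda>n. LINT x|?L. (cmod (deriv p (of_real x) - dx (\<psi> n) x))\<^sup>2) \<longlonglongrightarrow> 0"
  proof (rule dom)
    fix x assume x: "x \<in> I"
    have x1: "\<bar>x\<bar> \<le> 1" using x by auto
    have e: "real (Suc n) * (1 - x\<^sup>2) * bump 2 (T n x) = bump 1 (T n x) + bump 2 (T n x)" for n
    proof -
      have "real (Suc n) * (1 - x\<^sup>2) = T n x + 1" by (simp add: T_def)
      thus ?thesis
        using bump_Suc[of "T n x" 1] by (simp only:) (simp add: distrib_right numeral_2_eq_2)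
    qed
    have rest: "cmod (p (of_real x) * of_real (2 * real (Suc n) * x * bump 2 (T n x)))
        \<le> 2 * C * (bump 1 (T n x) + bump 2 (T n x))" for n
    proof -
      have "cmod (p (of_real x) * of_real (2 * real (Suc n) * x * bump 2 (T n x)))
         = cmod (p (of_real x)) * (2 * real (Suc n) * bump 2 (T n x)) * \<bar>x\<bar>"
        using bump_nonneg[of 2 "T n x"] by (simp only: norm_mult norm_of_real abs_mult) simp
      also have "\<dots> \<le> cmod (p (of_real x)) * (2 * real (Suc n) * bump 2 (T n x)) * 1"
        using x1 bump_nonneg[of 2 "T n x"] by (intro mult_left_mono) auto
      also have "\<dots> \<le> C * (1 - x\<^sup>2) * (2 * real (Suc n) * bump 2 (T n x))"
        using C(1)[OF x1] bump_nonneg[of 2 "T n x"] by (simp add: mult_right_mono)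
      also have "\<dots> = 2 * C * (real (Suc n) * (1 - x\<^sup>2) * bump 2 (T n x))" by simp
      also note e
      finally show ?thesis .
    qed
    have d: "deriv p (of_real x) - dx (\<psi> n) x = deriv p (of_real x) * of_real (1 - bump 0 (T n x))
        + p (of_real x) * of_real (2 * real (Suc n) * x * bump 2 (T n x))" for n
      unfolding d\<psi> by (simp add: algebra_simps)
    have "(\<lambda>n. 2 * C * (bump 1 (T n x) + bump 2 (T n x))) \<longlonglongrightarrow> 2 * C * (0 + 0)"
      using lb(2)[OF x, of 0] lb(2)[OF x, of 1] by (intro tendsto_intros) (simp_all add: numeral_2_eq_2)
    hence "(\<lambda>n. 2 * C * (bump 1 (T n x) + bump 2 (T n x))) \<longlonglongrightarrow> 0" by simp
    hence "(\<lambda>n. p (of_real x) * of_real (2 * real (Suc n) * x * bump 2 (T n x))) \<longlonglongrightarrow> 0"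
      by (rule Lim_null_comparison[rotated]) (use rest in \<open>auto intro!: always_eventually\<close>)
    moreover have "(\<lambda>n. deriv p (of_real x) * of_real (1 - bump 0 (T n x)))
        \<longlonglongrightarrow> deriv p (of_real x) * of_real (1 - 1)"
      by (intro tendsto_intros lb x)
    ultimately have "(\<lambda>n. deriv p (of_real x) - dx (\<psi> n) x) \<longlonglongrightarrow> deriv p (of_real x) * of_real (1 - 1) + 0"
      unfolding d by (intro tendsto_add)
    thus "(\<lambda>n. deriv p (of_real x) - dx (\<psi> n) x) \<longlonglongrightarrow> 0" by simp
    \<comment> \<open>The numbers 1 and 4 are the bounds k^k of \<open>bump_le\<close> for k = 1 and
      k = 2.\<close>
    show "cmod (deriv p (of_real x) - dx (\<psi> n) x) \<le> C * 1 + 2 * C * (1 + 4)" for n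
    proof -
      have "cmod (deriv p (of_real x) * of_real (1 - bump 0 (T n x))) \<le> C * 1"
        unfolding norm_mult norm_of_real using C(2)[OF x1] b01[of "T n x"] C0
        by (intro mult_mono) auto
      moreover have "2 * C * (bump 1 (T n x) + bump 2 (T n x)) \<le> 2 * C * (1 + 4)"
        using bump_le[of 1 "T n x"] bump_le[of 2 "T n x"] C0 by (intro mult_left_mono add_mono) auto
      ultimately show ?thesis
        unfolding d using rest[of n] by (intro norm_triangle_le) linarith
    qed
  qed (use w test_function_in_L2_I[OF test_function_dx[OF t]] in \<open>auto simp: weak_deriv_def\<close>)
  have "(\<lambda>n. (LINT x|?L. (cmod (p (of_real x) - \<psi> n x))\<^sup>2)
           + (LINT x|?L. (cmod (deriv p (of_real x) - dx (\<psi> n) x))\<^sup>2)) \<longlonglongrightarrow> 0 + 0"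
    by (intro tendsto_add l1 l2)
  thus ?thesis
    unfolding H10_def using w t by auto
qed

section \<open>The first eigenvalue\<close>

lemma first_eigenvalue_eq:
  assumes a: "1000 < \<alpha>"
  shows "first_eigenvalue \<alpha> = \<alpha> + real_shift \<alpha>"
proof -
  let ?L = "lebesgue_on I"
  define d where "d = real_shift \<alpha>"
  define p where "p = ground_state (of_real \<alpha>) (of_real d)"
  define p' where "p' = ground_state' (of_real \<alpha>) (of_real d)"
  define q where "q = (\<lambda>x::real. of_real ((\<alpha> * x)\<^sup>2 - (\<alpha> + d)) * p (of_real x))"
  have dp: "(p has_field_derivative p' x) (at x)" for x
    unfolding p_def p'_def by (rule ground_state_DERIV)
  have dp': "(p' has_field_derivative ((of_real \<alpha> * x)\<^sup>2 - of_real (\<alpha> + d)) * p x) (at x)" for x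
    unfolding p_def p'_def using ground_state'_DERIV by simp
  have vp: "((\<lambda>x. p (of_real x)) has_vector_derivative p' (of_real x)) (at x)" for x
    by (rule has_vector_derivative_real_field[OF dp])
  have vp': "((\<lambda>x. p' (of_real x)) has_vector_derivative q x) (at x)" for x
    by (rule has_vector_derivative_eq_rhs[OF has_vector_derivative_real_field[OF dp']]) (simp add: q_def)
  have cp: "continuous_on S (\<lambda>x. p (of_real x))" and cp': "continuous_on S (\<lambda>x. p' (of_real x))" for S
    using vp vp' by (meson continuous_at_imp_continuous_on has_vector_derivative_continuous)+
  have cq: "continuous_on S q" for S
    unfolding q_def by (intro continuous_intros cp)
  have hol: "p holomorphic_on UNIV"
    using dp by (auto simp: holomorphic_on_def field_differentiable_def)
  have real: "p (of_real x) = of_real (exp (- \<alpha> * x\<^sup>2 / 2) * (1 - d * Re (osc (of_real \<alpha>) (of_real d) (of_real x))))"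
    for x :: real
  proof -
    have "osc (of_real \<alpha>) (of_real d) (of_real x) \<in> \<real>" by (rule osc_in_Reals) auto
    hence "osc (of_real \<alpha>) (of_real d) (of_real x)
        = of_real (Re (osc (of_real \<alpha>) (of_real d) (of_real x)))" by simp
    thus ?thesis
      unfolding p_def ground_state_def
      by (simp add: exp_of_real[symmetric] del: of_real_Re)
  qed
  have pos: "0 < Re (p (of_real x))" if "x \<in> I" for x
    unfolding real using ground_factor_pos[OF a, of x] that by (simp add: d_def)
  \<comment> \<open>This is the fixed point equation d G(1) = 1; the point -1 follows since G is
    even.\<close>
  have p1: "p 1 = 0" "p (-1) = 0"
    using real[of 1] real[of "-1"] real_shift_bounds(4)[OF a] by (simp_all add: d_def)
  have w2: "weak_deriv2 I (\<lambda>x. p (of_real x)) q"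
    unfolding weak_deriv2_def using weak_deriv_of_C1[OF vp cp'] weak_deriv_of_C1[OF vp' cq] by blast
  have ev: "dirichlet_eigenvalue \<alpha> (of_real (\<alpha> + d))"
    unfolding dirichlet_eigenvalue_def dirichlet_oscillator_def
  proof (rule exI[of _ "\<lambda>x. p (of_real x)"], intro conjI exI[of _ q] w2)
    show "(\<lambda>x. p (of_real x)) \<in> H10 I \<inter> H2 I"
      using entire_vanishing_in_H10[OF hol p1] w2 by (auto simp: H2_def)
    show "(\<lambda>x. of_real (\<alpha> + d) * p (of_real x)) \<in> L2 I"
      by (intro continuous_in_L2_I continuous_intros cp)
    show "AE x in ?L. of_real (\<alpha> + d) * p (of_real x) = - q x + of_real ((\<alpha> * x)\<^sup>2) * p (of_real x)"
      by (intro AE_I2) (simp add: q_def algebra_simps)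
    show "\<not> (AE x in ?L. p (of_real x) = 0)"
    proof
      assume "AE x in ?L. p (of_real x) = 0"
      moreover have "AE x in ?L. p (of_real x) \<noteq> 0"
        using pos by (intro AE_I2) (force simp: space_restrict_space)
      ultimately have "AE x in ?L. False" by eventually_elim simp
      hence "AE x in ?L. x \<notin> space ?L" by (rule eventually_mono) simp
      hence "space ?L \<in> null_sets ?L" by (subst AE_iff_null_sets) (rule sets.top)
      hence "emeasure ?L (space ?L) = 0" by (rule null_setsD1)
      moreover have "emeasure ?L (space ?L) = 2"
        by (simp add: emeasure_restrict_space space_restrict_space)
      ultimately show False by simp
    qed
  qed
  show ?thesis
    unfolding first_eigenvalue_def d_def[symmetric]
  proof (rule Least_equality)
    show "dirichlet_eigenvalue \<alpha> (of_real (\<alpha> + d))" by (rule ev)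
    fix l assume l: "dirichlet_eigenvalue \<alpha> (of_real l)"
    show "\<alpha> + d \<le> l"
    proof (rule eigenvalue_ge[where \<phi> = "\<lambda>x. Re (p (of_real x))" and \<phi>' = "\<lambda>x. Re (p' (of_real x))", OF pos _ _ l])
      show "((\<lambda>x. Re (p (of_real x))) has_real_derivative Re (p' (of_real x))) (at x)" for x
        using bounded_linear.has_vector_derivative[OF bounded_linear_Re vp]
        by (simp add: has_real_derivative_iff_has_vector_derivative)
      have "Re (q x) = ((\<alpha> * x)\<^sup>2 - (\<alpha> + d)) * Re (p (of_real x))" for x
        unfolding q_def by (simp only: times_complex.sel Re_complex_of_real Im_complex_of_real)
      thus "((\<lambda>x. Re (p' (of_real x))) has_real_derivative
              ((\<alpha> * x)\<^sup>2 - (\<alpha> + d)) * Re (p (of_real x))) (at x)" for x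
        using bounded_linear.has_vector_derivative[OF bounded_linear_Re vp'[of x]]
        by (simp add: has_real_derivative_iff_has_vector_derivative)
    qed
  qed
qed

section \<open>Sectors and the symbol class\<close>

text \<open>In the sector Re z > |z| cos \<theta>, so (Re z)^2 > |z| |z| cos^2 \<theta> > 1000 |z|;
  the radius is chosen for the last inequality.\<close>

lemma sector_subset_parabolic_region:
  assumes \<theta>: "\<theta> \<in> {0<..<pi/2}"
  shows "sector \<theta> (1000 / (cos \<theta>)\<^sup>2) \<subseteq> parabolic_region"
proof
  fix z assume "z \<in> sector \<theta> (1000 / (cos \<theta>)\<^sup>2)"
  hence n: "1000 / (cos \<theta>)\<^sup>2 < norm z" and A: "\<bar>Arg z\<bar> < \<theta>" by (auto simp: sector_def)
  have c: "0 < cos \<theta>" using \<theta> by (intro cos_gt_zero) auto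
  hence "0 < 1000 / (cos \<theta>)\<^sup>2" by simp
  hence n0: "0 < norm z" using n by (rule order.strict_trans)
  have "cos \<theta> < cos \<bar>Arg z\<bar>"
    using A \<theta> by (intro cos_monotone_0_pi) auto
  hence "norm z * cos \<theta> < norm z * cos (Arg z)" using n0 by simp
  also have "\<dots> = Re z"
    by (metis Re_rcis rcis_cmod_Arg)
  finally have x: "norm z * cos \<theta> < Re z" .
  moreover have "0 < norm z * cos \<theta>" using n0 c by simp
  ultimately have "(norm z * cos \<theta>)\<^sup>2 < (Re z)\<^sup>2" by (intro power_strict_mono) auto
  moreover have "1000 < norm z * (cos \<theta>)\<^sup>2"
    using n c by (simp add: field_simps)
  hence "1000 * norm z < norm z * (cos \<theta>)\<^sup>2 * norm z" using n0 by (intro mult_strict_right_mono)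
  ultimately show "z \<in> parabolic_region"
    using x \<open>0 < norm z * cos \<theta>\<close> by (simp add: parabolic_region_def power2_eq_square mult_ac)
qed

lemma square_mult_exp_le:
  fixes e t :: real
  assumes "e > 0" "t \<ge> 0"
  shows "t\<^sup>2 * exp (- e * t) \<le> 4 / e\<^sup>2"
proof -
  have "(e * t / 2)\<^sup>2 \<le> (1 + e * t / real 2) ^ 2"
    using assms by (intro power_mono) auto
  also have "\<dots> \<le> exp (e * t)"
    using order_trans[of "- 2" 0 "e * t"] assms by (intro exp_ge_one_plus_x_over_n_power_n) auto
  finally show ?thesis
    using assms by (simp add: exp_minus power_mult_distrib power_divide field_simps)
qed

theorem theorem22:
  shows "\<exists>(r :: real \<Rightarrow> real) (\<gamma> :: complex \<Rightarrow> complex).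
    (\<forall>\<theta>\<in>{0<..<pi/2}. 0 \<le> r \<theta>) \<and> mono_on {0<..<pi/2} r \<and> \<gamma> \<in> symbols r \<and>
    (\<forall>\<alpha> :: real. \<alpha> > radius_at_zero r \<longrightarrow>
       complex_of_real (first_eigenvalue \<alpha>) =
         of_real \<alpha> + \<gamma> (of_real \<alpha>) * of_real (exp (- \<alpha>)))"
proof -
  define r :: "real \<Rightarrow> real" where "r = (\<lambda>\<theta>. 1000 / (cos \<theta>)\<^sup>2)"
  \<comment> \<open>The factor e^z cancels the decay e^(-Re z) in \<open>shift_bound\<close> exactly
    and leaves 64 |z|^2.\<close>
  define \<gamma> where "\<gamma> = (\<lambda>z. eigenvalue_shift z * exp z)"
  have cpos: "0 < cos \<theta>" if "\<theta> \<in> {0<..<pi/2}" for \<theta>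
    using that by (intro cos_gt_zero) auto
  have "mono_on {0<..<pi/2} r"
  proof (rule mono_onI)
    fix s t :: real assume st: "s \<in> {0<..<pi/2}" "t \<in> {0<..<pi/2}" "s \<le> t"
    have "cos t \<le> cos s" using st by (intro cos_monotone_0_pi_le) auto
    hence "(cos t)\<^sup>2 \<le> (cos s)\<^sup>2" using cpos[OF st(2)] by (intro power_mono) auto
    thus "r s \<le> r t"
      unfolding r_def using cpos[OF st(1)] cpos[OF st(2)]
      by (intro divide_left_mono mult_pos_pos zero_less_power) auto
  qed
  moreover have "\<gamma> \<in> symbols r"
    unfolding symbols_def
  proof (intro CollectI conjI ballI allI impI)
    have "symbol_domain r \<subseteq> parabolic_region"
      unfolding symbol_domain_def r_def by (intro UN_least sector_subset_parabolic_region)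
    moreover have "\<gamma> holomorphic_on parabolic_region"
      unfolding \<gamma>_def by (intro holomorphic_intros eigenvalue_shift_holomorphic)
    ultimately show "\<gamma> holomorphic_on symbol_domain r" by (rule holomorphic_on_subset[rotated])
    fix \<theta> \<epsilon> :: real assume \<theta>: "\<theta> \<in> {0<..<pi/2}" and \<epsilon>: "\<epsilon> > 0"
    have "cmod (\<gamma> z * of_real (exp (- \<epsilon> * cmod z))) \<le> 64 * (4 / \<epsilon>\<^sup>2)" if "z \<in> sector \<theta> (r \<theta>)" for z
    proof -
      have z: "z \<in> parabolic_region" using that sector_subset_parabolic_region[OF \<theta>] by (auto simp: r_def)
      have "cmod (\<gamma> z) = cmod (eigenvalue_shift z) * exp (Re z)" by (simp add: \<gamma>_def norm_mult)
      also have "\<dots> \<le> shift_bound z * exp (Re z)"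
        using norm_eigenvalue_shift_le[OF z] by (intro mult_right_mono) auto
      also have "\<dots> = 64 * (cmod z)\<^sup>2" by (simp add: shift_bound_def exp_minus)
      finally have "cmod (\<gamma> z * of_real (exp (- \<epsilon> * cmod z))) \<le> 64 * (cmod z)\<^sup>2 * exp (- \<epsilon> * cmod z)"
        unfolding norm_mult norm_of_real by (simp add: mult_right_mono)
      also have "\<dots> = 64 * ((cmod z)\<^sup>2 * exp (- \<epsilon> * cmod z))" by simp
      also have "\<dots> \<le> 64 * (4 / \<epsilon>\<^sup>2)"
        using square_mult_exp_le[OF \<epsilon>, of "cmod z"] by (intro mult_left_mono) auto
      finally show ?thesis .
    qed
    hence "symbol_seminorm r \<theta> \<epsilon> \<gamma> \<le> ennreal (64 * (4 / \<epsilon>\<^sup>2))"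
      unfolding symbol_seminorm_def by (intro SUP_least ennreal_leI)
    thus "symbol_seminorm r \<theta> \<epsilon> \<gamma> < \<infinity>"
      by (rule le_less_trans) simp
  qed
  moreover have "complex_of_real (first_eigenvalue \<alpha>) = of_real \<alpha> + \<gamma> (of_real \<alpha>) * of_real (exp (- \<alpha>))"
    if "\<alpha> > radius_at_zero r" for \<alpha>
  proof -
    \<comment> \<open>Every r(\<theta>) is at least 1000 because cos^2 \<theta> \<le> 1, so each
      admissible \<alpha> lies in the range where the ground state has been constructed.\<close>
    have "1000 \<le> radius_at_zero r"
      unfolding radius_at_zero_def
    proof (rule cINF_greatest)
      show "{0<..<pi/2} \<noteq> {}" using pi_gt_zero by (simp add: not_le)
      fix \<theta> :: real assume \<theta>: "\<theta> \<in> {0<..<pi/2}"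
      have "(cos \<theta>)\<^sup>2 \<le> 1" by (simp add: cos_squared_eq)
      thus "1000 \<le> r \<theta>" using cpos[OF \<theta>] by (simp add: r_def field_simps)
    qed
    hence a: "1000 < \<alpha>" using that by simp
    have "\<gamma> (of_real \<alpha>) * of_real (exp (- \<alpha>)) = of_real (real_shift \<alpha>)"
      by (simp add: \<gamma>_def of_real_real_shift[OF a] exp_minus flip: exp_of_real)
    thus ?thesis by (simp add: first_eigenvalue_eq[OF a])
  qed
  moreover have "\<forall>\<theta>\<in>{0<..<pi/2}. 0 \<le> r \<theta>" by (simp add: r_def)
  ultimately show ?thesis by blast
qed

end
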